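(* Let $f\in C([0,\infty),\mathbb{R})$ with $f(0)=0$ satisfy $(f_\infty)$, and let $p>1$. Then for every $k\in\mathbb{N}$ there exists $\lambda_k>0$ such that for every $\lambda\in[-\lambda_k,\lambda_k]$ the problem $$(-\Delta)^s u=\lambda u^p+f(u),\ u>0 \text{ in }\Omega,\qquad u=0 \text{ in }\mathbb{R}^N\setminus\Omega$$ has at least $k$ distinct (nontrivial, nonnegative) weak solutions $u_{1,\lambda},\dots,u_{k,\lambda}\in X_0^s(\Omega)$, and $\|u_{i,\lambda}\|_{L^\infty(\Omega)}>i-1$ for every $i\in\{1,\dots,k\}$.
   Context: $\Omega\subset\mathbb{R}^N$ ($N\ge2$, $N>2s$) is a bounded smooth domain, $s\in(0,1)$, $(-\Delta)^s$ the fractional Laplacian. $X_0^s(\Omega)=\{u\in H^s(\mathbb{R}^N): u=0 \text{ a.e. in }\mathbb{R}^N\setminus\Omega\}$ with norm $\|u\|_{X_0^s(\Omega)}^2=\int_{\mathbb{R}^{2N}}\frac{|u(x)-u(y)|^2}{|x-y|^{N+2s}}dxdy$. $F(t)=\int_0^tf$. Condition $(f_\infty)$: $-\infty<\liminf_{t\to\infty}F(t)/t^2\le\limsup_{t\to\infty}F(t)/t^2=+\infty$ and $l_\infty:=\liminf_{t\to\infty}f(t)/t<0$. Nonlinearities are extended by $0$ for $u\le0$. Weak solutions are defined by $\int_{\mathbb{R}^{2N}}\frac{(u(x)-u(y))(\varphi(x)-\varphi(y))}{|x-y|^{N+2s}}dxdy=\lambda\int_\Omega u^p\varphi+\int_\Omega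 f(u)\varphi$ for all $\varphi\in X_0^s(\Omega)$. *)

theory Defs
  imports "HOL-Analysis.Analysis" "HOL-Probability.Essential_Supremum"
begin

fun Ck_on :: "nat \<Rightarrow> 'a::euclidean_space set \<Rightarrow> ('a \<Rightarrow> real) \<Rightarrow> bool" where
  "Ck_on 0 S g = continuous_on S g"
| "Ck_on (Suc k) S g = (continuous_on S g \<and> (\<forall>x\<in>S. g differentiable (at x)) \<and>
      (\<forall>i\<in>Basis. Ck_on k S (\<lambda>x. frechet_derivative g (at x) i)))"

definition smooth_on :: "'a::euclidean_space set \<Rightarrow> ('a \<Rightarrow> real) \<Rightarrow> bool" where
  "smooth_on S g \<longleftrightarrow> (\<forall>k. Ck_on k S g)"

definition bounded_smooth_domain :: "'a::euclidean_space set \<Rightarrow> bool" where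
  "bounded_smooth_domain \<Omega> \<longleftrightarrow> bounded \<Omega> \<and> open \<Omega> \<and> connected \<Omega> \<and> \<Omega> \<noteq> {} \<and>
     (\<exists>\<rho>. smooth_on UNIV \<rho> \<and> \<Omega> = {x. \<rho> x < 0} \<and>
          (\<forall>x. \<rho> x = 0 \<longrightarrow> (\<exists>v. frechet_derivative \<rho> (at x) v \<noteq> 0)))"

definition gagliardo_form :: "real \<Rightarrow> (real^'n \<Rightarrow> real) \<Rightarrow> (real^'n \<Rightarrow> real) \<Rightarrow> real" where
  "gagliardo_form s u v =
     (\<integral>z. (u (fst z) - u (snd z)) * (v (fst z) - v (snd z)) /
            dist (fst z) (snd z) powr (real CARD('n) + 2 * s) \<partial>(lborel \<Otimes>\<^sub>M lborel))"

definition Hs :: "real \<Rightarrow> (real^'n \<Rightarrow> real) set" where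
  "Hs s = {u. u \<in> borel_measurable lborel \<and> integrable lborel (\<lambda>x. (u x)\<^sup>2) \<and>
             integrable (lborel \<Otimes>\<^sub>M lborel)
               (\<lambda>z. (u (fst z) - u (snd z))\<^sup>2 / dist (fst z) (snd z) powr (real CARD('n) + 2 * s))}"

definition X0 :: "real \<Rightarrow> (real^'n) set \<Rightarrow> (real^'n \<Rightarrow> real) set" where
  "X0 s \<Omega> = {u \<in> Hs s. AE x in lborel. x \<notin> \<Omega> \<longrightarrow> u x = 0}"

text \<open>Weak solution of (-Delta)^s u = lambda u^p + f(u) in Omega, u = 0 outside,
  with the nonlinearities extended by 0 for u \<le> 0 (i.e. evaluated at max u 0,
  using f 0 = 0).\<close>
definition weak_solution ::
  "real \<Rightarrow> (real^'n) set \<Rightarrow> real \<Rightarrow> real \<Rightarrow> (real \<Rightarrow> real) \<Rightarrow> (real^'n \<Rightarrow> real) \<Rightarrow> bool" where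
  "weak_solution s \<Omega> p lam f u \<longleftrightarrow> u \<in> X0 s \<Omega> \<and>
     (\<forall>\<phi>\<in>X0 s \<Omega>.
        set_integrable lborel \<Omega> (\<lambda>x. max (u x) 0 powr p * \<phi> x) \<and>
        set_integrable lborel \<Omega> (\<lambda>x. f (max (u x) 0) * \<phi> x) \<and>
        gagliardo_form s u \<phi> =
          lam * (LINT x:\<Omega>|lborel. max (u x) 0 powr p * \<phi> x)
          + (LINT x:\<Omega>|lborel. f (max (u x) 0) * \<phi> x))"

end

theory Submission
  imports Defs "HOL-Real_Asymp.Real_Asymp" "HOL-Complex_Analysis.Great_Picard"
begin

text \<open>
  Let $T > 0$ with $f(T) < 0$. For small $|\<lambda>|$ the nonlinearity $\<lambda> t^p + f(t)$ is still
  nonpositive at $T$; freezing it outside $[0,T]$ gives a bounded continuous function whose energy does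
  not increase when a function is clamped to $[0,T]$. Hence a global minimizer exists with values in
  $[0,T]$, and it solves the original problem. Because $F(t)/t^2$ is unbounded above and bounded below,
  multiples of a cutoff have arbitrarily negative energy, whereas functions with values in $[0,R]$ have
  energy bounded below uniformly in small $\<lambda>$. So for $T$ large compared with $R$ the
  minimizer exceeds $R$ on a set of positive measure. Iterating this with $R$ at least the previous
  $T$ separates the solutions.
\<close>

section \<open>The Gagliardo form\<close>

text \<open>Neither \<open>p\<close> nor \<open>f\<close> obeys a growth bound from above, so the
  energy of the original problem need not be finite on all of \<open>X0\<close>, and a Sobolev
  embedding need not control it. Freezing makes the potential Lipschitz, and clamping a minimizing
  sequence makes it uniformly bounded. Almost everywhere convergence of a subsequence is then all
  that is required: Fatou treats the Gagliardo term, dominated convergence the potential. Such a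
  subsequence comes from an L^1 estimate against dyadic averages, which takes the place of a compact
  embedding theorem.

  The order of the choices is decisive. The level R fixes a lower bound for the energy of functions
  with values in [0,R]; this bound fixes a competitor w; only then is T taken above both R and the
  bound on w; the range of lambda comes last and depends on T. The values of w thus stay in the
  interval where the nonlinearity is unchanged, and an energy gap of 1 survives the perturbation by
  lambda.\<close>

definition gagliardo_density :: "real \<Rightarrow> (real^'n \<Rightarrow> real) \<Rightarrow> (real^'n) \<times> (real^'n) \<Rightarrow> real" where
  "gagliardo_density s u z =
     (u (fst z) - u (snd z))\<^sup>2 / dist (fst z) (snd z) powr (real CARD('n) + 2 * s)"

lemma gagliardo_density_nonneg [simp]: "0 \<le> gagliardo_density s u z"
  by (simp add: gagliardo_density_def)

lemma measurable_lborel_pair: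
  "measurable (lborel \<Otimes>\<^sub>M lborel) M = measurable (borel \<Otimes>\<^sub>M borel) M"
  by (intro measurable_cong_sets sets_pair_measure_cong) auto

lemma borel_measurable_gagliardo_density [measurable]:
  assumes [measurable]: "u \<in> borel_measurable borel"
  shows "gagliardo_density s u \<in> borel_measurable (lborel \<Otimes>\<^sub>M lborel)"
  unfolding gagliardo_density_def measurable_lborel_pair by measurable

lemma gagliardo_form_self: "gagliardo_form s u u = integral\<^sup>L (lborel \<Otimes>\<^sub>M lborel) (gagliardo_density s u)"
  unfolding gagliardo_form_def gagliardo_density_def power2_eq_square ..

lemma gagliardo_form_self_nonneg: "0 \<le> gagliardo_form s u u"
  unfolding gagliardo_form_self by (intro Bochner_Integration.integral_nonneg) auto

lemma X0_iff:
  "u \<in> X0 s \<Omega> \<longleftrightarrow> u \<in> borel_measurable borel \<and> integrable lborel (\<lambda>x. (u x)\<^sup>2) \<and>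
     integrable (lborel \<Otimes>\<^sub>M lborel) (gagliardo_density s u) \<and> (AE x in lborel. x \<notin> \<Omega> \<longrightarrow> u x = 0)"
  by (auto simp: X0_def Hs_def gagliardo_density_def [abs_def])

text \<open>Young's inequality for the mixed product. It dominates the bilinear integrand by the two
  diagonal densities, so the form is an honest integral on \<open>X0\<close>.\<close>

lemma gagliardo_density_product_bound:
  "\<bar>(u (fst z) - u (snd z)) * (v (fst z) - v (snd z)) /
      dist (fst z) (snd z) powr (real CARD('n) + 2 * s)\<bar> \<le> gagliardo_density s u z + gagliardo_density s v z"
  for u v :: "real^'n \<Rightarrow> real"
proof -
  have "\<bar>a * b\<bar> \<le> a\<^sup>2 + b\<^sup>2" for a b :: real
    using sum_squares_bound[of "\<bar>a\<bar>" "\<bar>b\<bar>"] abs_ge_zero[of "a*b"] unfolding abs_mult power2_abs by linarith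
  then show ?thesis
    by (simp add: gagliardo_density_def abs_divide add_divide_distrib [symmetric] divide_right_mono)
qed

lemma gagliardo_form_integrable:
  fixes u v :: "real^'n \<Rightarrow> real"
  assumes "u \<in> X0 s \<Omega>" "v \<in> X0 s \<Omega>"
  shows "integrable (lborel \<Otimes>\<^sub>M lborel) (\<lambda>z. (u (fst z) - u (snd z)) * (v (fst z) - v (snd z)) /
            dist (fst z) (snd z) powr (real CARD('n) + 2 * s))"
proof (rule Bochner_Integration.integrable_bound)
  show "integrable (lborel \<Otimes>\<^sub>M lborel) (\<lambda>z. gagliardo_density s u z + gagliardo_density s v z)"
    using assms by (simp add: X0_iff)
  have [measurable]: "u \<in> borel_measurable borel" "v \<in> borel_measurable borel"
    using assms by (auto simp: X0_iff)
  show "(\<lambda>z. (u (fst z) - u (snd z)) * (v (fst z) - v (snd z)) /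
            dist (fst z) (snd z) powr (real CARD('n) + 2 * s)) \<in> borel_measurable (lborel \<Otimes>\<^sub>M lborel)"
    unfolding measurable_lborel_pair by measurable
qed (use gagliardo_density_product_bound[of u _ v s] in auto)

section \<open>Linear combinations and contractions in \<open>X0\<close>\<close>

lemma gagliardo_density_add_scale:
  "gagliardo_density s (\<lambda>x. u x + c * v x) z = gagliardo_density s u z +
     2 * c * ((u (fst z) - u (snd z)) * (v (fst z) - v (snd z)) /
            dist (fst z) (snd z) powr (real CARD('n) + 2 * s)) + c\<^sup>2 * gagliardo_density s v z"
  for u v :: "real^'n \<Rightarrow> real"
  unfolding gagliardo_density_def times_divide_eq_right add_divide_distrib [symmetric]
  by (rule arg_cong2[where f="(/)"]) (auto simp: power2_eq_square algebra_simps)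

text \<open>One statement serves the variations u + c phi and, with u = 0, the multiples - phi and
  tau psi.\<close>

lemma X0_add_scale:
  assumes u: "u \<in> X0 s \<Omega>" and v: "v \<in> X0 s \<Omega>"
  shows "(\<lambda>x. u x + c * v x) \<in> X0 s \<Omega>"
  unfolding X0_iff
proof (intro conjI)
  have [measurable]: "u \<in> borel_measurable borel" "v \<in> borel_measurable borel"
    using assms by (auto simp: X0_iff)
  show "(\<lambda>x. u x + c * v x) \<in> borel_measurable borel" by measurable
  show "integrable lborel (\<lambda>x. (u x + c * v x)\<^sup>2)"
  proof (rule Bochner_Integration.integrable_bound)
    show "integrable lborel (\<lambda>x. 2 * (u x)\<^sup>2 + 2 * c\<^sup>2 * (v x)\<^sup>2)"
      using assms by (auto simp: X0_iff)
    have "(a + b)\<^sup>2 \<le> 2 * a\<^sup>2 + 2 * b\<^sup>2" for a b :: real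
      using sum_squares_bound[of a b] by (simp add: power2_sum)
    then have "(u x + c * v x)\<^sup>2 \<le> 2 * (u x)\<^sup>2 + 2 * (c * v x)\<^sup>2" for x .
    then show "AE x in lborel. norm ((u x + c * v x)\<^sup>2) \<le> norm (2 * (u x)\<^sup>2 + 2 * c\<^sup>2 * (v x)\<^sup>2)"
      by (intro AE_I2) (simp add: power_mult_distrib mult.assoc)
  qed measurable
  show "integrable (lborel \<Otimes>\<^sub>M lborel) (gagliardo_density s (\<lambda>x. u x + c * v x))"
    unfolding gagliardo_density_add_scale
    by (intro Bochner_Integration.integrable_add integrable_mult_right gagliardo_form_integrable[OF u v])
       (use assms in \<open>auto simp: X0_iff\<close>)
  have "AE x in lborel. x \<notin> \<Omega> \<longrightarrow> u x = 0" "AE x in lborel. x \<notin> \<Omega> \<longrightarrow> v x = 0"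
    using assms by (auto simp: X0_iff)
  then show "AE x in lborel. x \<notin> \<Omega> \<longrightarrow> u x + c * v x = 0"
    by eventually_elim auto
qed

lemma gagliardo_form_add_scale:
  assumes u: "u \<in> X0 s \<Omega>" and v: "v \<in> X0 s \<Omega>"
  shows "gagliardo_form s (\<lambda>x. u x + c * v x) (\<lambda>x. u x + c * v x) =
     gagliardo_form s u u + 2 * c * gagliardo_form s u v + c\<^sup>2 * gagliardo_form s v v"
proof -
  note [simp] = gagliardo_form_integrable[OF u v]
  have [simp]: "integrable (lborel \<Otimes>\<^sub>M lborel) (gagliardo_density s u)"
    "integrable (lborel \<Otimes>\<^sub>M lborel) (gagliardo_density s v)"
    using assms by (auto simp: X0_iff)
  show ?thesis
    unfolding gagliardo_form_self gagliardo_density_add_scale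
    by (simp add: Bochner_Integration.integral_add integrable_mult_right gagliardo_form_def
        del: times_divide_eq_right)
qed

lemma gagliardo_density_contraction:
  assumes "\<And>a b. \<bar>T a - T b\<bar> \<le> \<bar>a - b\<bar>"
  shows "gagliardo_density s (\<lambda>x. T (u x)) z \<le> gagliardo_density s u z"
  unfolding gagliardo_density_def
  by (intro divide_right_mono) (use assms in \<open>auto simp: abs_le_square_iff\<close>)

text \<open>A 1-Lipschitz map shrinks every difference u(x) - u(y), hence the density pointwise.
  Fixing 0 gives |T a| <= |a|, which preserves square integrability, and keeps the function zero
  outside the domain.\<close>

lemma X0_contraction:
  fixes T :: "real \<Rightarrow> real"
  assumes u: "u \<in> X0 s \<Omega>" and T: "\<And>a b. \<bar>T a - T b\<bar> \<le> \<bar>a - b\<bar>" and "T 0 = 0"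
    and Tm [measurable]: "T \<in> borel_measurable borel"
  shows "(\<lambda>x. T (u x)) \<in> X0 s \<Omega>"
    and "gagliardo_form s (\<lambda>x. T (u x)) (\<lambda>x. T (u x)) \<le> gagliardo_form s u u"
proof -
  have [measurable]: "u \<in> borel_measurable borel" using u by (auto simp: X0_iff)
  have d: "integrable (lborel \<Otimes>\<^sub>M lborel) (gagliardo_density s u)" using u by (auto simp: X0_iff)
  have i: "integrable (lborel \<Otimes>\<^sub>M lborel) (gagliardo_density s (\<lambda>x. T (u x)))"
    by (rule Bochner_Integration.integrable_bound[OF d])
       (use gagliardo_density_contraction[OF T, of s u] in auto)
  show "(\<lambda>x. T (u x)) \<in> X0 s \<Omega>"
    unfolding X0_iff
  proof (intro conjI)
    show "integrable lborel (\<lambda>x. (T (u x))\<^sup>2)"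
    proof (rule Bochner_Integration.integrable_bound)
      show "integrable lborel (\<lambda>x. (u x)\<^sup>2)" using u by (auto simp: X0_iff)
      have "\<bar>T a\<bar> \<le> \<bar>a\<bar>" for a using T[of a 0] \<open>T 0 = 0\<close> by simp
      then show "AE x in lborel. norm ((T (u x))\<^sup>2) \<le> norm ((u x)\<^sup>2)"
        by (auto simp: abs_le_square_iff)
    qed measurable
    show "AE x in lborel. x \<notin> \<Omega> \<longrightarrow> T (u x) = 0"
      using u \<open>T 0 = 0\<close> by (auto simp: X0_iff)
  qed (use i in auto)
  show "gagliardo_form s (\<lambda>x. T (u x)) (\<lambda>x. T (u x)) \<le> gagliardo_form s u u"
    unfolding gagliardo_form_self
    by (rule integral_mono[OF i d]) (rule gagliardo_density_contraction[OF T])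
qed

section \<open>Almost everywhere limits and lower semicontinuity\<close>

lemma AE_pair_lborel:
  assumes "AE x in lborel. P x"
  shows "AE z in lborel \<Otimes>\<^sub>M lborel. P (fst z) \<and> P (snd z)"
proof -
  \<comment> \<open>The exceptional set itself need not be measurable; a measurable null superset
    makes the product predicate measurable, as the product criterion demands.\<close>
  obtain N where N: "{x. \<not> P x} \<subseteq> N" "emeasure lborel N = 0" "N \<in> sets lborel"
    using AE_E[OF assms] by auto
  have [measurable]: "N \<in> sets borel" using N by simp
  have ae: "AE x in lborel. x \<notin> N"
    using N by (intro AE_not_in) (auto simp: null_sets_def)
  have "AE z in lborel \<Otimes>\<^sub>M lborel. fst z \<notin> N \<and> snd z \<notin> N"
  proof (intro lborel_pair.AE_pair_measure)
    have "Measurable.pred (borel \<Otimes>\<^sub>M borel) (\<lambda>z. fst z \<notin> N \<and> snd z \<notin> N)"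
      by measurable
    then show "{z \<in> space (lborel \<Otimes>\<^sub>M lborel). fst z \<notin> N \<and> snd z \<notin> N} \<in> sets (lborel \<Otimes>\<^sub>M lborel)"
      unfolding measurable_lborel_pair[symmetric] by (rule predE)
  qed (use ae in auto)
  then show ?thesis by eventually_elim (use N in auto)
qed

text \<open>Fatou on the product space: a.e. convergence of the functions gives a.e. convergence of
  the densities for pairs. Finiteness of the bound also puts the limit into \<open>X0\<close>.
  Square integrability is a separate premise, supplied by boundedness in the application.\<close>

lemma gagliardo_lower_semicontinuous:
  fixes u :: "real^'n \<Rightarrow> real"
  assumes un: "\<And>n. un n \<in> X0 s \<Omega>"
    and u [measurable]: "u \<in> borel_measurable borel"
    and lim: "AE x in lborel. (\<lambda>n. un n x) \<longlonglongrightarrow> u x"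
    and sq: "integrable lborel (\<lambda>x. (u x)\<^sup>2)"
    and L: "(\<lambda>n. gagliardo_form s (un n) (un n)) \<longlonglongrightarrow> L"
  shows "u \<in> X0 s \<Omega>" and "gagliardo_form s u u \<le> L"
proof -
  let ?P = "lborel \<Otimes>\<^sub>M lborel :: ((real^'n) \<times> (real^'n)) measure"
  have [measurable]: "un n \<in> borel_measurable borel" for n using un by (auto simp: X0_iff)
  have i: "integrable ?P (gagliardo_density s (un n))" for n
    using un by (auto simp: X0_iff)
  have L0: "0 \<le> L"
    by (rule LIMSEQ_le_const[OF L]) (auto simp: gagliardo_form_self_nonneg)
  have "AE z in ?P. (\<lambda>n. un n (fst z)) \<longlonglongrightarrow> u (fst z) \<and> (\<lambda>n. un n (snd z)) \<longlonglongrightarrow> u (snd z)"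
    using AE_pair_lborel[OF lim] .
  then have "AE z in ?P. ennreal (gagliardo_density s u z) =
      liminf (\<lambda>n. ennreal (gagliardo_density s (un n) z))"
  proof eventually_elim
    case (elim z)
    have "(\<lambda>n. gagliardo_density s (un n) z) \<longlonglongrightarrow> gagliardo_density s u z"
      unfolding gagliardo_density_def divide_inverse using elim by (intro tendsto_intros) auto
    then have "(\<lambda>n. ennreal (gagliardo_density s (un n) z)) \<longlonglongrightarrow> ennreal (gagliardo_density s u z)"
      by (rule tendsto_ennrealI)
    then show ?case by (intro lim_imp_Liminf[symmetric]) auto
  qed
  then have "(\<integral>\<^sup>+z. gagliardo_density s u z \<partial>?P) = (\<integral>\<^sup>+z. liminf (\<lambda>n. ennreal (gagliardo_density s (un n) z)) \<partial>?P)"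
    by (rule nn_integral_cong_AE)
  also have "\<dots> \<le> liminf (\<lambda>n. \<integral>\<^sup>+z. gagliardo_density s (un n) z \<partial>?P)"
    by (rule nn_integral_liminf) measurable
  also have "(\<lambda>n. \<integral>\<^sup>+z. gagliardo_density s (un n) z \<partial>?P) = (\<lambda>n. ennreal (gagliardo_form s (un n) (un n)))"
    unfolding gagliardo_form_self using i by (auto intro!: ext nn_integral_eq_integral)
  also have "liminf \<dots> = ennreal L"
    using tendsto_ennrealI[OF L] by (simp add: lim_imp_Liminf)
  finally have le: "(\<integral>\<^sup>+z. gagliardo_density s u z \<partial>?P) \<le> ennreal L" .
  have int: "integrable ?P (gagliardo_density s u)"
    by (rule integrableI_nonneg) (use le in \<open>auto simp: less_top[symmetric] top_unique\<close>)
  show "u \<in> X0 s \<Omega>" unfolding X0_iff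
  proof (intro conjI)
    have "AE x in lborel. \<forall>n. x \<notin> \<Omega> \<longrightarrow> un n x = 0"
      unfolding AE_all_countable using un by (auto simp: X0_iff)
    with lim show "AE x in lborel. x \<notin> \<Omega> \<longrightarrow> u x = 0"
    proof eventually_elim
      case (elim x)
      then show ?case using LIMSEQ_unique[of "\<lambda>n. un n x" "u x" 0] by (auto simp: tendsto_const_iff)
    qed
  qed (use sq int in auto)
  have "ennreal (gagliardo_form s u u) = (\<integral>\<^sup>+z. gagliardo_density s u z \<partial>?P)"
    unfolding gagliardo_form_self using int by (intro nn_integral_eq_integral[symmetric]) auto
  with le have "ennreal (gagliardo_form s u u) \<le> ennreal L" by simp
  then show "gagliardo_form s u u \<le> L" using L0 by (simp only: ennreal_le_iff)
qed

text \<open>On a set of finite measure, 2|v| <= 1 + v^2 turns square integrability into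
  integrability. This provides the dominating functions for potentials of linear growth.\<close>

lemma X0_set_integrable:
  fixes v :: "real^'n \<Rightarrow> real"
  assumes v: "v \<in> X0 s \<Omega>" and "open \<Omega>" "bounded \<Omega>"
  shows "set_integrable lborel \<Omega> v"
  unfolding set_integrable_def
proof (rule Bochner_Integration.integrable_bound)
  have [measurable]: "v \<in> borel_measurable borel" "\<Omega> \<in> sets borel" using v assms by (auto simp: X0_iff)
  show "integrable lborel (\<lambda>x. indicator \<Omega> x + (v x)\<^sup>2)"
    using v emeasure_bounded_finite[OF \<open>bounded \<Omega>\<close>]
    by (intro Bochner_Integration.integrable_add integrable_real_indicator) (auto simp: X0_iff)
  show "AE x in lborel. norm (indicat_real \<Omega> x *\<^sub>R v x) \<le> norm (indicator \<Omega> x + (v x)\<^sup>2)"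
  proof (intro AE_I2)
    fix x
    have "2 * \<bar>v x\<bar> \<le> 1 + (v x)\<^sup>2" using sum_squares_bound[of 1 "\<bar>v x\<bar>"] by simp
    then show "norm (indicat_real \<Omega> x *\<^sub>R v x) \<le> norm (indicator \<Omega> x + (v x)\<^sup>2)"
      by (auto simp: indicator_def)
  qed
  show "(\<lambda>x. indicat_real \<Omega> x *\<^sub>R v x) \<in> borel_measurable lborel" by measurable
qed

section \<open>Compactness via dyadic averages\<close>

text \<open>Half-open cubes of side 2^-m, named by integer vectors. They partition the space at each
  scale, and the labels over all scales form a countable set, as the diagonal extraction
  needs.\<close>

definition dyadic_cell :: "nat \<Rightarrow> real^'n \<Rightarrow> int^'n" where
  "dyadic_cell m x = (\<chi> i. \<lfloor>2 ^ m * x $ i\<rfloor>)"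

text \<open>The prefactor is the reciprocal of the cell volume. Composed with
  \<open>dyadic_cell m\<close> this is the conditional expectation of u on the m-th dyadic
  sigma-algebra; keeping the label k as an argument exposes it as a countable family of
  numbers.\<close>

definition cell_average :: "nat \<Rightarrow> (real^'n \<Rightarrow> real) \<Rightarrow> int^'n \<Rightarrow> real" where
  "cell_average m u k = 2 ^ (m * CARD('n)) * (\<integral>y. indicator {y. dyadic_cell m y = k} y * u y \<partial>lborel)"

lemma borel_measurable_vec_nth' [measurable (raw)]:
  fixes f :: "'a \<Rightarrow> real^'n"
  assumes "f \<in> borel_measurable M"
  shows "(\<lambda>x. f x $ i) \<in> borel_measurable M"
  using assms by (rule measurable_compose) (intro borel_measurable_continuous_onI continuous_intros)

lemma pred_dyadic_cell_eq [measurable]: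
  fixes k :: "int^'n"
  shows "Measurable.pred borel (\<lambda>y. dyadic_cell m y = k)"
  unfolding dyadic_cell_def vec_eq_iff vec_lambda_beta
  by (rule pred_intros_countable) measurable

lemma sets_dyadic_cell [measurable, simp]: "{y. dyadic_cell m y = k} \<in> sets borel"
  using predE[OF pred_dyadic_cell_eq[of m k]] by simp

text \<open>A half-open cube lies between an open and a closed box of equal volume.\<close>

lemma emeasure_dyadic_cell:
  fixes k :: "int^'n"
  shows "emeasure lborel {y. dyadic_cell m y = k} = ennreal (1 / 2 ^ (m * CARD('n)))"
proof (rule antisym)
  define a b :: "real^'n" where "a = (\<chi> i. k $ i / 2 ^ m)" and "b = (\<chi> i. (k $ i + 1) / 2 ^ m)"
  have le: "a \<bullet> i \<le> b \<bullet> i" if "i \<in> Basis" for i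
    using that unfolding Basis_vec_def a_def b_def by (auto simp: inner_axis divide_right_mono)
  have vol: "(\<Prod>i\<in>Basis. (b - a) \<bullet> i) = 1 / 2 ^ (m * CARD('n))"
  proof -
    have "(\<Prod>i\<in>Basis. (b - a) \<bullet> i) = (\<Prod>i\<in>(Basis :: (real^'n) set). 1 / 2 ^ m)"
      by (rule prod.cong) (auto simp: Basis_vec_def a_def b_def inner_axis add_divide_distrib)
    also have "\<dots> = 1 / 2 ^ (m * CARD('n))"
      by (simp add: power_mult power_divide)
    finally show ?thesis .
  qed
  have iff: "dyadic_cell m y = k \<longleftrightarrow> (\<forall>i. a $ i \<le> y $ i \<and> y $ i < b $ i)" for y
    unfolding dyadic_cell_def vec_eq_iff a_def b_def
    by (auto simp: floor_eq_iff field_simps)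
  have "emeasure lborel {y. dyadic_cell m y = k} \<le> emeasure lborel (cbox a b)"
    by (rule emeasure_mono) (auto simp: iff mem_box_cart less_imp_le)
  also have "\<dots> = ennreal (1 / 2 ^ (m * CARD('n)))"
    using vol le by (simp add: emeasure_lborel_cbox_eq)
  finally show "emeasure lborel {y. dyadic_cell m y = k} \<le> ennreal (1 / 2 ^ (m * CARD('n)))" .
  have "ennreal (1 / 2 ^ (m * CARD('n))) = emeasure lborel (box a b)"
    using vol le by (simp add: emeasure_lborel_box_eq)
  also have "\<dots> \<le> emeasure lborel {y. dyadic_cell m y = k}"
    by (rule emeasure_mono) (auto simp: iff mem_box_cart less_imp_le)
  finally show "ennreal (1 / 2 ^ (m * CARD('n))) \<le> emeasure lborel {y. dyadic_cell m y = k}" .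
qed

lemma measure_dyadic_cell:
  fixes k :: "int^'n"
  shows "measure lborel {y. dyadic_cell m y = k} = 1 / 2 ^ (m * CARD('n))"
  by (simp add: measure_def emeasure_dyadic_cell)

text \<open>Passing through the l^1 norm costs a factor \<open>CARD('n)\<close> instead of its
  square root; only the decay in m matters.\<close>

lemma dist_dyadic_cell:
  fixes x y :: "real^'n"
  assumes "dyadic_cell m x = dyadic_cell m y"
  shows "dist x y \<le> real CARD('n) / 2 ^ m"
proof -
  have "\<bar>(x - y) $ i\<bar> \<le> 1 / 2 ^ m" for i
  proof -
    have "\<lfloor>2 ^ m * x $ i\<rfloor> = \<lfloor>2 ^ m * y $ i\<rfloor>"
      using assms by (auto simp: dyadic_cell_def vec_eq_iff)
    then have "\<bar>2 ^ m * x $ i - 2 ^ m * y $ i\<bar> \<le> 1" by linarith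
    then show ?thesis
      by (simp add: field_simps abs_le_iff)
  qed
  then have "(\<Sum>i\<in>UNIV. \<bar>(x - y) $ i\<bar>) \<le> (\<Sum>i\<in>(UNIV :: 'n set). 1 / 2 ^ m)"
    by (intro sum_mono) auto
  with norm_le_l1_cart[of "x - y"] show ?thesis by (simp add: dist_norm)
qed

lemma measurable_dyadic_cell_eq [measurable]:
  "Measurable.pred (borel \<Otimes>\<^sub>M borel) (\<lambda>z :: (real^'n) \<times> (real^'n). dyadic_cell m (snd z) = dyadic_cell m (fst z))"
  unfolding dyadic_cell_def vec_eq_iff vec_lambda_beta
  by (rule pred_intros_countable) measurable

text \<open>The domain of integration moves with x. The relation of lying in the same cell is
  measurable on the product, so the average is a measurable parametric integral.\<close>

lemma borel_measurable_cell_average [measurable]: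
  fixes u :: "real^'n \<Rightarrow> real"
  assumes [measurable]: "u \<in> borel_measurable borel"
  shows "(\<lambda>x. cell_average m u (dyadic_cell m x)) \<in> borel_measurable borel"
proof -
  have "(\<lambda>x. \<integral>y. indicator {y. dyadic_cell m y = dyadic_cell m x} y * u y \<partial>lborel) \<in> borel_measurable borel"
  proof (rule lborel.borel_measurable_lebesgue_integral)
    have "(\<lambda>z. indicator {z. dyadic_cell m (snd z) = dyadic_cell m (fst z)} z * u (snd z)) \<in> borel_measurable (borel \<Otimes>\<^sub>M borel)"
      by measurable
    then show "(\<lambda>(x, y). indicat_real {y. dyadic_cell m y = dyadic_cell m x} y * u y) \<in> borel_measurable (borel \<Otimes>\<^sub>M lborel)"
      unfolding measurable_cong_sets[OF sets_pair_measure_cong[OF refl sets_lborel] refl]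
      by (simp add: case_prod_beta' indicator_def)
  qed
  then show ?thesis unfolding cell_average_def by measurable
qed

lemma integrable_cell:
  fixes u :: "real^'n \<Rightarrow> real"
  assumes [measurable]: "u \<in> borel_measurable borel" and bd: "\<And>x. \<bar>u x\<bar> \<le> M"
  shows "integrable lborel (\<lambda>y. indicator {y. dyadic_cell m y = k} y * u y)"
proof (rule Bochner_Integration.integrable_bound)
  show "integrable lborel (\<lambda>y. indicat_real {y. dyadic_cell m y = k} y * M)"
    by (intro integrable_mult_left integrable_real_indicator) (auto simp: emeasure_dyadic_cell)
  have "0 \<le> M" using bd[of undefined] by linarith
  then show "AE y in lborel. norm (indicat_real {y. dyadic_cell m y = k} y * u y) \<le> norm (indicat_real {y. dyadic_cell m y = k} y * M)"
    using bd by (auto simp: indicator_def)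
qed measurable

lemma cell_average_bound:
  fixes u :: "real^'n \<Rightarrow> real"
  assumes um: "u \<in> borel_measurable borel" and bd: "\<And>x. \<bar>u x\<bar> \<le> M"
  shows "\<bar>cell_average m u k\<bar> \<le> M"
proof -
  have "0 \<le> M" using bd[of undefined] by linarith
  have "\<bar>\<integral>y. indicator {y. dyadic_cell m y = k} y * u y \<partial>lborel\<bar> \<le> (\<integral>y. indicator {y. dyadic_cell m y = k} y * M \<partial>lborel)"
    unfolding real_norm_def[symmetric]
  proof (rule Bochner_Integration.integral_norm_bound_integral[OF integrable_cell[OF um bd]])
    show "integrable lborel (\<lambda>y. indicat_real {y. dyadic_cell m y = k} y * M)"
      by (rule integrable_cell[where M=M]) (use \<open>0 \<le> M\<close> in auto)
  qed (use bd in \<open>auto simp: indicator_def\<close>)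
  also have "\<dots> = M / 2 ^ (m * CARD('n))"
    by (simp add: measure_dyadic_cell)
  finally show ?thesis
    unfolding cell_average_def abs_mult by (simp add: field_simps)
qed

text \<open>
  Estimating in $L^1$ through $|a| \<le> d^s + d^{-s} a^2$, instead of in $L^2$, keeps the bound
  linear in the Gagliardo density.
\<close>

lemma cell_average_error_pointwise:
  fixes u :: "real^'n \<Rightarrow> real"
  assumes um [measurable]: "u \<in> borel_measurable borel" and bd: "\<And>x. \<bar>u x\<bar> \<le> M"
    and d: "d = real CARD('n) / 2 ^ m" and "0 < s"
  shows "ennreal \<bar>u x - cell_average m u (dyadic_cell m x)\<bar> \<le>
     ennreal (d powr s) + ennreal (2 ^ (m * CARD('n)) * d powr (real CARD('n) + s)) * (\<integral>\<^sup>+y. gagliardo_density s u (x, y) \<partial>lborel)"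
proof -
  let ?C = "{y. dyadic_cell m y = dyadic_cell m x}"
  let ?V = "2 ^ (m * CARD('n)) :: real"
  let ?N = "real CARD('n)"
  have "0 < d" unfolding d by simp
  have "u x = ?V * (\<integral>y. indicator ?C y * u x \<partial>lborel)"
    by (simp add: measure_dyadic_cell)
  then have "u x - cell_average m u (dyadic_cell m x) =
     ?V * ((\<integral>y. indicator ?C y * u x \<partial>lborel) - (\<integral>y. indicator ?C y * u y \<partial>lborel))"
    unfolding cell_average_def right_diff_distrib by simp
  also have "(\<integral>y. indicator ?C y * u x \<partial>lborel) - (\<integral>y. indicator ?C y * u y \<partial>lborel)
     = (\<integral>y. indicator ?C y * (u x - u y) \<partial>lborel)"
    unfolding right_diff_distrib
    by (intro Bochner_Integration.integral_diff[symmetric] integrable_cell) (use bd in auto)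
  finally have eq: "\<bar>u x - cell_average m u (dyadic_cell m x)\<bar> = ?V * \<bar>\<integral>y. indicator ?C y * (u x - u y) \<partial>lborel\<bar>"
    by (simp add: abs_mult)
  have i: "integrable lborel (\<lambda>y. indicator ?C y * (u x - u y))"
  proof (rule integrable_cell[where M="2 * M"])
    show "\<bar>u x - u y\<bar> \<le> 2 * M" for y using bd[of x] bd[of y] by linarith
  qed measurable
  \<comment> \<open>Since d bounds the diameter of the cell, the squared difference is at most the
    density times \<open>d powr (?N + 2 * s)\<close>; dividing by \<open>d powr s\<close> leaves the
    exponent \<open>?N + s\<close>. On the diagonal the left side is 0.\<close>
  have pw: "\<bar>u x - u y\<bar> \<le> d powr s + d powr (?N + s) * gagliardo_density s u (x, y)" if "y \<in> ?C" for y
  proof (cases "x = y")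
    case False
    let ?a = "\<bar>u x - u y\<bar>"
    let ?D = "d powr s"
    have "0 < ?D" using \<open>0 < d\<close> by simp
    have "dist x y \<le> d" unfolding d using dist_dyadic_cell[of m x y] that by simp
    have "?a\<^sup>2 = gagliardo_density s u (x, y) * dist x y powr (?N + 2 * s)"
      using False by (simp add: gagliardo_density_def)
    also have "\<dots> \<le> gagliardo_density s u (x, y) * d powr (?N + 2 * s)"
      by (intro mult_left_mono powr_mono2) (use \<open>dist x y \<le> d\<close> \<open>0 < s\<close> in auto)
    also have "d powr (?N + 2 * s) = ?D * d powr (?N + s)"
    proof -
      have "?N + 2 * s = s + (?N + s)" by simp
      then show ?thesis by (simp only: powr_add)
    qed
    finally have *: "?a\<^sup>2 \<le> ?D * (d powr (?N + s) * gagliardo_density s u (x, y))"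
      by (simp add: mult_ac)
    show ?thesis
    proof (cases "?a \<le> ?D")
      case False
      then have "?D * ?a \<le> ?a\<^sup>2" unfolding power2_eq_square by (intro mult_right_mono) auto
      with * have "?D * ?a \<le> ?D * (d powr (?N + s) * gagliardo_density s u (x, y))" by linarith
      then have "?a \<le> d powr (?N + s) * gagliardo_density s u (x, y)"
        using \<open>0 < ?D\<close> by (simp only: mult_le_cancel_left_pos)
      then show ?thesis using \<open>0 < ?D\<close> by linarith
    next
      case True
      moreover have "0 \<le> d powr (?N + s) * gagliardo_density s u (x, y)" by simp
      ultimately show ?thesis by linarith
    qed
  qed auto
  have "ennreal \<bar>\<integral>y. indicator ?C y * (u x - u y) \<partial>lborel\<bar> \<le> (\<integral>\<^sup>+y. \<bar>indicator ?C y * (u x - u y)\<bar> \<partial>lborel)"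
    using integral_norm_bound_ennreal[OF i] by simp
  \<comment> \<open>The density term drops its indicator: extending it from the cell to the whole
    space lets a later integration in x produce the full Gagliardo form.\<close>
  also have "\<dots> \<le> (\<integral>\<^sup>+y. ennreal (d powr s) * indicator ?C y + ennreal (d powr (?N + s)) * ennreal (gagliardo_density s u (x, y)) \<partial>lborel)"
  proof (rule nn_integral_mono)
    fix y
    show "ennreal \<bar>indicator ?C y * (u x - u y)\<bar> \<le> ennreal (d powr s) * indicator ?C y + ennreal (d powr (?N + s)) * ennreal (gagliardo_density s u (x, y))"
    proof (cases "y \<in> ?C")
      case True
      have "ennreal \<bar>u x - u y\<bar> \<le> ennreal (d powr s + d powr (?N + s) * gagliardo_density s u (x, y))"
        using pw[OF True] by (rule ennreal_leI)
      also have "\<dots> = ennreal (d powr s) + ennreal (d powr (?N + s)) * ennreal (gagliardo_density s u (x, y))"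
        by (simp add: ennreal_plus ennreal_mult)
      finally show ?thesis using True by simp
    qed simp
  qed
  also have "\<dots> = ennreal (d powr s) * emeasure lborel ?C + ennreal (d powr (?N + s)) * (\<integral>\<^sup>+y. gagliardo_density s u (x, y) \<partial>lborel)"
    by (subst nn_integral_add) (auto simp: nn_integral_cmult nn_integral_cmult_indicator)
  finally have le: "ennreal \<bar>\<integral>y. indicator ?C y * (u x - u y) \<partial>lborel\<bar> \<le> \<dots>" .
  have "ennreal \<bar>u x - cell_average m u (dyadic_cell m x)\<bar> = ennreal ?V * ennreal \<bar>\<integral>y. indicator ?C y * (u x - u y) \<partial>lborel\<bar>"
    unfolding eq by (simp add: ennreal_mult)
  also have "\<dots> \<le> ennreal ?V * (ennreal (d powr s) * emeasure lborel ?C + ennreal (d powr (?N + s)) * (\<integral>\<^sup>+y. gagliardo_density s u (x, y) \<partial>lborel))"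
    by (intro mult_left_mono le) auto
  also have "\<dots> = ennreal (d powr s) * (ennreal ?V * emeasure lborel ?C) + ennreal (?V * d powr (?N + s)) * (\<integral>\<^sup>+y. gagliardo_density s u (x, y) \<partial>lborel)"
    by (simp add: distrib_left ennreal_mult mult_ac)
  also have "ennreal ?V * emeasure lborel ?C = 1"
    unfolding emeasure_dyadic_cell by (simp add: ennreal_mult[symmetric])
  finally show ?thesis by simp
qed

text \<open>Tonelli turns the pointwise bound into the Gagliardo form. Since 2^m d = N, the factor
  \<open>2 ^ (m * CARD('n)) * d powr (?N + s)\<close> collapses to N^N d^s, so the error decays like
  2^(-ms), uniformly over functions of bounded energy.\<close>

lemma X0_cell_average_error:
  fixes u :: "real^'n \<Rightarrow> real"
  assumes u: "u \<in> X0 s \<Omega>" and bd: "\<And>x. \<bar>u x\<bar> \<le> M" and "0 < s" and \<Omega>: "open \<Omega>" "bounded \<Omega>"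
  shows "(\<integral>x. indicator \<Omega> x * \<bar>u x - cell_average m u (dyadic_cell m x)\<bar> \<partial>lborel)
     \<le> (real CARD('n) / 2 ^ m) powr s * (measure lborel \<Omega> + real CARD('n) ^ CARD('n) * gagliardo_form s u u)"
proof -
  let ?N = "real CARD('n)"
  define d where "d = ?N / 2 ^ m"
  have "0 < d" unfolding d_def by simp
  have [measurable]: "u \<in> borel_measurable borel" "\<Omega> \<in> sets borel" using u \<Omega> by (auto simp: X0_iff)
  let ?c = "2 ^ (m * CARD('n)) * d powr (?N + s)"
  have c: "?c = d powr s * ?N ^ CARD('n)"
  proof -
    have "d powr (?N + s) = d powr s * d ^ CARD('n)"
      using \<open>0 < d\<close> by (simp add: powr_add powr_realpow)
    then show ?thesis
      by (simp add: d_def power_divide power_mult)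
  qed
  have fin: "emeasure lborel \<Omega> = ennreal (measure lborel \<Omega>)"
    using emeasure_bounded_finite[OF \<open>bounded \<Omega>\<close>] by (intro emeasure_eq_ennreal_measure) auto
  have gm: "(\<lambda>z. ennreal (gagliardo_density s u z)) \<in> borel_measurable (lborel \<Otimes>\<^sub>M lborel)"
    by measurable
  have gm2 [measurable]: "(\<lambda>x. \<integral>\<^sup>+y. gagliardo_density s u (x, y) \<partial>lborel) \<in> borel_measurable borel"
    using lborel.borel_measurable_nn_integral_fst[OF gm] by simp
  have "(\<integral>\<^sup>+x. ennreal (indicator \<Omega> x * \<bar>u x - cell_average m u (dyadic_cell m x)\<bar>) \<partial>lborel)
    \<le> (\<integral>\<^sup>+x. ennreal (d powr s) * indicator \<Omega> x + ennreal ?c * (\<integral>\<^sup>+y. gagliardo_density s u (x, y) \<partial>lborel) \<partial>lborel)"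
  proof (rule nn_integral_mono)
    fix x
    show "ennreal (indicator \<Omega> x * \<bar>u x - cell_average m u (dyadic_cell m x)\<bar>)
      \<le> ennreal (d powr s) * indicator \<Omega> x + ennreal ?c * (\<integral>\<^sup>+y. gagliardo_density s u (x, y) \<partial>lborel)"
      using cell_average_error_pointwise[where x=x and u=u and M=M and s=s, OF _ bd d_def \<open>0 < s\<close>]
      by (cases "x \<in> \<Omega>") auto
  qed
  also have "\<dots> = ennreal (d powr s) * emeasure lborel \<Omega> + ennreal ?c * (\<integral>\<^sup>+x. \<integral>\<^sup>+y. gagliardo_density s u (x, y) \<partial>lborel \<partial>lborel)"
    by (subst nn_integral_add) (auto simp: nn_integral_cmult nn_integral_cmult_indicator)
  also have "(\<integral>\<^sup>+x. \<integral>\<^sup>+y. gagliardo_density s u (x, y) \<partial>lborel \<partial>lborel) = (\<integral>\<^sup>+z. gagliardo_density s u z \<partial>(lborel \<Otimes>\<^sub>M lborel))"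
    by (rule lborel.nn_integral_fst[OF gm])
  also have "\<dots> = ennreal (gagliardo_form s u u)"
    unfolding gagliardo_form_self using u by (intro nn_integral_eq_integral) (auto simp: X0_iff)
  also have "ennreal (d powr s) * emeasure lborel \<Omega> + ennreal ?c * ennreal (gagliardo_form s u u)
    = ennreal (d powr s * (measure lborel \<Omega> + ?N ^ CARD('n) * gagliardo_form s u u))"
    unfolding fin c using gagliardo_form_self_nonneg[of s u]
    by (simp add: ennreal_mult[symmetric] ennreal_plus[symmetric] distrib_left mult_ac del: ennreal_plus)
  finally have le: "(\<integral>\<^sup>+x. ennreal (indicator \<Omega> x * \<bar>u x - cell_average m u (dyadic_cell m x)\<bar>) \<partial>lborel)
    \<le> ennreal (d powr s * (measure lborel \<Omega> + ?N ^ CARD('n) * gagliardo_form s u u))" .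
  have "(\<integral>x. indicator \<Omega> x * \<bar>u x - cell_average m u (dyadic_cell m x)\<bar> \<partial>lborel)
    = enn2real (\<integral>\<^sup>+x. ennreal (indicator \<Omega> x * \<bar>u x - cell_average m u (dyadic_cell m x)\<bar>) \<partial>lborel)"
    by (rule integral_eq_nn_integral) auto
  also have "\<dots> \<le> d powr s * (measure lborel \<Omega> + ?N ^ CARD('n) * gagliardo_form s u u)"
    by (rule enn2real_leI[OF _ le]) (use gagliardo_form_self_nonneg[of s u] in auto)
  finally show ?thesis unfolding d_def .
qed

section \<open>Extraction of an a.e. convergent subsequence\<close>

lemma integrable_indicator_bounded:
  fixes f :: "real^'n \<Rightarrow> real"
  assumes "open \<Omega>" "bounded \<Omega>" and fm: "f \<in> borel_measurable borel" and bd: "\<And>x. x \<in> \<Omega> \<Longrightarrow> \<bar>f x\<bar> \<le> M"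
  shows "integrable lborel (\<lambda>x. indicator \<Omega> x * f x)"
proof (rule Bochner_Integration.integrable_bound)
  have [measurable]: "\<Omega> \<in> sets borel" using assms by auto
  note [measurable] = fm
  show "integrable lborel (\<lambda>x. indicator \<Omega> x * M)"
    using emeasure_bounded_finite[OF \<open>bounded \<Omega>\<close>]
    by (intro integrable_mult_left integrable_real_indicator) auto
  show "(\<lambda>x. indicator \<Omega> x * f x) \<in> borel_measurable lborel" by measurable
  show "AE x in lborel. norm (indicator \<Omega> x * f x) \<le> norm (indicator \<Omega> x * M)"
  proof (rule AE_I2)
    fix x show "norm (indicator \<Omega> x * f x) \<le> norm (indicator \<Omega> x * M)"
      using bd[of x] by (cases "x \<in> \<Omega>") auto
  qed
qed

text \<open>The averages form countably many bounded sequences, so a diagonal subsequence makes all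
  of them converge. At each fixed scale this is L^1 convergence on the domain, and replacing the
  functions by their averages costs \<open>\<delta> m\<close>, uniformly in n. Hence the subsequence
  is Cauchy in L^1, and a further one converges a.e.\<close>

lemma X0_AE_convergent_subsequence:
  fixes un :: "nat \<Rightarrow> real^'n \<Rightarrow> real"
  assumes un: "\<And>n. un n \<in> X0 s \<Omega>" and bd: "\<And>n x. \<bar>un n x\<bar> \<le> M"
    and gag: "\<And>n. gagliardo_form s (un n) (un n) \<le> B"
    and "0 < s" and \<Omega>: "open \<Omega>" "bounded \<Omega>"
  obtains r where "strict_mono r" "AE x in lborel. convergent (\<lambda>n. un (r n) x)"
proof -
  have [measurable]: "un n \<in> borel_measurable borel" "\<Omega> \<in> sets borel" for n using un \<Omega> by (auto simp: X0_iff)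
  \<comment> \<open>The index pairs a scale with a cell label, so a single extraction serves all
    scales.\<close>
  obtain k :: "nat \<Rightarrow> nat" where k: "strict_mono k"
    "\<And>x. x \<in> (UNIV :: (nat \<times> (int^'n)) set) \<Longrightarrow> \<exists>l. (\<lambda>n. cell_average (fst x) (un (k n)) (snd x)) \<longlonglongrightarrow> l"
  proof (rule function_convergent_subsequence[of UNIV "\<lambda>n x. cell_average (fst x) (un n) (snd x)" M])
    show "norm (cell_average (fst x) (un n) (snd x)) \<le> M" for n and x :: "nat \<times> (int^'n)"
      using cell_average_bound[of "un n" M] bd by simp
  qed auto
  define v where "v n = un (k n)" for n
  have vm [measurable]: "v n \<in> borel_measurable borel" for n unfolding v_def by measurable
  define P where "P m n x = cell_average m (v n) (dyadic_cell m x)" for m n x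
  have Pm [measurable]: "P m n \<in> borel_measurable borel" for m n unfolding P_def by measurable
  have vbd: "\<bar>v n x\<bar> \<le> M" for n x using bd by (simp add: v_def)
  have Pbd: "\<bar>P m n x\<bar> \<le> M" for m n x
    unfolding P_def by (intro cell_average_bound vbd) auto
  have "\<exists>l. (\<lambda>n. P m n x) \<longlonglongrightarrow> l" for m x
    using k(2)[of "(m, dyadic_cell m x)"] by (simp add: P_def v_def)
  then obtain w where w: "\<And>m x. (\<lambda>n. P m n x) \<longlonglongrightarrow> w m x" by metis
  have wm [measurable]: "w m \<in> borel_measurable borel" for m
    by (rule borel_measurable_LIMSEQ_real[OF w]) auto
  have wbd: "\<bar>w m x\<bar> \<le> M" for m x
    by (rule LIMSEQ_le_const2[OF tendsto_rabs[OF w[of m x]]]) (use Pbd in auto)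
  have int: "integrable lborel (\<lambda>x. indicator \<Omega> x * \<bar>f x - g x\<bar>)"
    if [measurable]: "f \<in> borel_measurable borel" "g \<in> borel_measurable borel" and "\<And>x. \<bar>f x\<bar> \<le> M" "\<And>x. \<bar>g x\<bar> \<le> M" for f g :: "real^'n \<Rightarrow> real"
  proof (rule integrable_indicator_bounded[OF \<Omega>, where M="2*M"])
    show "\<bar>\<bar>f x - g x\<bar>\<bar> \<le> 2 * M" for x using that(3)[of x] that(4)[of x] by linarith
  qed measurable
  have Pw: "(\<lambda>n. \<integral>x. indicator \<Omega> x * \<bar>P m n x - w m x\<bar> \<partial>lborel) \<longlonglongrightarrow> 0" for m
  proof -
    have "(\<lambda>n. \<integral>x. indicator \<Omega> x * \<bar>P m n x - w m x\<bar> \<partial>lborel) \<longlonglongrightarrow> (\<integral>x. 0 \<partial>(lborel :: (real^'n) measure))"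
    proof (rule integral_dominated_convergence[where w="\<lambda>x. indicator \<Omega> x * (2 * M)"])
      show "integrable lborel (\<lambda>x. indicat_real \<Omega> x * (2 * M))"
        by (rule integrable_indicator_bounded[OF \<Omega>]) auto
      have "(\<lambda>n. indicat_real \<Omega> x * \<bar>P m n x - w m x\<bar>) \<longlonglongrightarrow> 0" for x
        using w[of m x] by (intro tendsto_mult_right_zero tendsto_rabs_zero) (simp add: LIM_zero)
      then show "AE x in lborel. (\<lambda>n. indicat_real \<Omega> x * \<bar>P m n x - w m x\<bar>) \<longlonglongrightarrow> 0" by auto
      have "norm (indicat_real \<Omega> x * \<bar>P m n x - w m x\<bar>) \<le> indicat_real \<Omega> x * (2 * M)" for n x
      proof -
        have "\<bar>P m n x - w m x\<bar> \<le> 2 * M" using Pbd[of m n x] wbd[of m x] by linarith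
        then show ?thesis by (simp add: indicator_def)
      qed
      then show "AE x in lborel. norm (indicat_real \<Omega> x * \<bar>P m n x - w m x\<bar>) \<le> indicat_real \<Omega> x * (2 * M)" for n by auto
    qed measurable
    then show ?thesis by simp
  qed
  define C where "C = measure lborel \<Omega> + real CARD('n) ^ CARD('n) * B"
  define \<delta> where "\<delta> m = (real CARD('n) / 2 ^ m) powr s * C" for m
  have vP: "(\<integral>x. indicator \<Omega> x * \<bar>v n x - P m n x\<bar> \<partial>lborel) \<le> \<delta> m" for m n
  proof -
    have "(\<integral>x. indicator \<Omega> x * \<bar>v n x - P m n x\<bar> \<partial>lborel)
      \<le> (real CARD('n) / 2 ^ m) powr s * (measure lborel \<Omega> + real CARD('n) ^ CARD('n) * gagliardo_form s (v n) (v n))"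
      unfolding P_def by (rule X0_cell_average_error[OF _ vbd \<open>0 < s\<close> \<Omega>]) (simp add: v_def un)
    also have "\<dots> \<le> \<delta> m"
      unfolding \<delta>_def C_def by (intro mult_left_mono add_left_mono) (auto simp: v_def gag)
    finally show ?thesis .
  qed
  have \<delta>0: "\<delta> \<longlonglongrightarrow> 0"
  proof -
    have "(\<lambda>m. real CARD('n) * (1 / 2) ^ m) \<longlonglongrightarrow> real CARD('n) * 0"
      by (intro tendsto_mult tendsto_const LIMSEQ_power_zero) auto
    then have "(\<lambda>m. real CARD('n) / 2 ^ m) \<longlonglongrightarrow> 0" by (simp add: power_divide)
    then have "(\<lambda>m. (real CARD('n) / 2 ^ m) powr s) \<longlonglongrightarrow> 0 powr s"
      by (rule tendsto_powr2) (use \<open>0 < s\<close> in auto)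
    then show ?thesis unfolding \<delta>_def[abs_def] using tendsto_mult_left_zero by fastforce
  qed
  have cauchy: "\<exists>N. \<forall>i\<ge>N. \<forall>j\<ge>N. (\<integral>x. norm (indicator \<Omega> x * v i x - indicator \<Omega> x * v j x) \<partial>lborel) < e" if "0 < e" for e
  proof -
    \<comment> \<open>The scale m is fixed first and N is chosen for it. The four quarters of e are
      two averaging errors and two distances of averages to \<open>w m\<close>.\<close>
    have "\<forall>\<^sub>F m in sequentially. \<delta> m < e / 4"
      using order_tendstoD(2)[OF \<delta>0, of "e / 4"] that by simp
    then obtain m where m: "\<delta> m < e / 4"
      using eventually_happens'[OF sequentially_bot] by blast
    have "\<forall>\<^sub>F n in sequentially. (\<integral>x. indicator \<Omega> x * \<bar>P m n x - w m x\<bar> \<partial>lborel) < e / 4"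
      using order_tendstoD(2)[OF Pw[of m], of "e / 4"] that by simp
    then obtain N where N: "\<And>n. n \<ge> N \<Longrightarrow> (\<integral>x. indicator \<Omega> x * \<bar>P m n x - w m x\<bar> \<partial>lborel) < e / 4"
      unfolding eventually_sequentially by blast
    have "(\<integral>x. norm (indicator \<Omega> x * v i x - indicator \<Omega> x * v j x) \<partial>lborel) < e" if ij: "i \<ge> N" "j \<ge> N" for i j
    proof -
      have "(\<integral>x. norm (indicator \<Omega> x * v i x - indicator \<Omega> x * v j x) \<partial>lborel)
        = (\<integral>x. indicator \<Omega> x * \<bar>v i x - v j x\<bar> \<partial>lborel)"
        by (intro Bochner_Integration.integral_cong) (auto simp: indicator_def)
      also have "\<dots> \<le> (\<integral>x. (indicator \<Omega> x * \<bar>v i x - P m i x\<bar> + indicator \<Omega> x * \<bar>P m i x - w m x\<bar>)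
         + (indicator \<Omega> x * \<bar>v j x - P m j x\<bar> + indicator \<Omega> x * \<bar>P m j x - w m x\<bar>) \<partial>lborel)"
      proof (rule integral_mono)
        show "indicat_real \<Omega> x * \<bar>v i x - v j x\<bar> \<le> (indicator \<Omega> x * \<bar>v i x - P m i x\<bar> + indicator \<Omega> x * \<bar>P m i x - w m x\<bar>)
         + (indicator \<Omega> x * \<bar>v j x - P m j x\<bar> + indicator \<Omega> x * \<bar>P m j x - w m x\<bar>)" for x
        proof -
          have "\<bar>v i x - v j x\<bar> \<le> (\<bar>v i x - P m i x\<bar> + \<bar>P m i x - w m x\<bar>) + (\<bar>v j x - P m j x\<bar> + \<bar>P m j x - w m x\<bar>)"
            by linarith
          then show ?thesis by (simp add: indicator_def)
        qed
      qed (intro Bochner_Integration.integrable_add int vm Pm wm vbd Pbd wbd)+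
      also have "\<dots> = ((\<integral>x. indicator \<Omega> x * \<bar>v i x - P m i x\<bar> \<partial>lborel) + (\<integral>x. indicator \<Omega> x * \<bar>P m i x - w m x\<bar> \<partial>lborel))
         + ((\<integral>x. indicator \<Omega> x * \<bar>v j x - P m j x\<bar> \<partial>lborel) + (\<integral>x. indicator \<Omega> x * \<bar>P m j x - w m x\<bar> \<partial>lborel))"
        by (simp add: int vbd Pbd wbd)
      also have "\<dots> < e"
        using vP[of i m] vP[of j m] N[OF ij(1)] N[OF ij(2)] m by linarith
      finally show ?thesis .
    qed
    then show ?thesis by blast
  qed
  obtain r where r: "strict_mono r" "AE x in lborel. Cauchy (\<lambda>i. indicator \<Omega> x * v (r i) x)"
  proof (rule cauchy_L1_AE_cauchy_subseq[of lborel "\<lambda>n x. indicator \<Omega> x * v n x"])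
    show "integrable lborel (\<lambda>x. indicator \<Omega> x * v n x)" for n
      by (rule integrable_indicator_bounded[OF \<Omega> vm vbd])
  qed (use cauchy in auto)
  show thesis
  proof (rule that[of "k \<circ> r"])
    show "strict_mono (k \<circ> r)" using k r by (simp add: strict_mono_o)
    \<comment> \<open>The L^1 argument sees only the domain; outside it all terms vanish off one
      common null set.\<close>
    have "AE x in lborel. \<forall>n. x \<notin> \<Omega> \<longrightarrow> v n x = 0"
      unfolding AE_all_countable using un by (auto simp: X0_iff v_def)
    with r(2) show "AE x in lborel. convergent (\<lambda>n. un ((k \<circ> r) n) x)"
    proof eventually_elim
      case (elim x)
      then have "indicator \<Omega> x * v n x = v n x" for n by (auto simp: indicator_def)
      with elim(1) have "Cauchy (\<lambda>i. v (r i) x)" by simp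
      then show ?case by (simp add: v_def Cauchy_convergent_iff)
    qed
  qed
qed

section \<open>Minimizers for truncated nonlinearities\<close>

definition energy :: "real \<Rightarrow> (real^'n) set \<Rightarrow> (real \<Rightarrow> real) \<Rightarrow> (real^'n \<Rightarrow> real) \<Rightarrow> real" where
  "energy s \<Omega> H u = gagliardo_form s u u / 2 - (\<integral>x. indicator \<Omega> x * H (u x) \<partial>lborel)"

definition clamp_to :: "real \<Rightarrow> real \<Rightarrow> real" where
  "clamp_to T t = max 0 (min T t)"

lemma clamp_to_contraction: "\<bar>clamp_to T a - clamp_to T b\<bar> \<le> \<bar>a - b\<bar>"
  by (auto simp: clamp_to_def max_def min_def)

lemma continuous_on_clamp_to [continuous_intros]:
  "continuous_on S f \<Longrightarrow> continuous_on S (\<lambda>x. clamp_to T (f x))"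
  unfolding clamp_to_def by (intro continuous_intros)

lemma borel_measurable_clamp_to [measurable]: "clamp_to T \<in> borel_measurable borel"
  by (intro borel_measurable_continuous_onI continuous_intros)

lemma zero_in_X0: "(\<lambda>x. 0) \<in> X0 s \<Omega>"
  by (simp add: X0_iff gagliardo_density_def[abs_def])

lemma X0_bounded_mult_integrable:
  assumes "b \<in> borel_measurable borel" "\<And>x. \<bar>b x\<bar> \<le> C" "\<phi> \<in> X0 s \<Omega>" and \<Omega>: "open \<Omega>" "bounded \<Omega>"
  shows "integrable lborel (\<lambda>x. indicator \<Omega> x * (b x * \<phi> x))"
proof (rule Bochner_Integration.integrable_bound)
  have [measurable]: "b \<in> borel_measurable borel" "\<phi> \<in> borel_measurable borel" "\<Omega> \<in> sets borel"
    using assms by (auto simp: X0_iff)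
  have "0 \<le> C" using assms(2)[of undefined] by linarith
  show "integrable lborel (\<lambda>x. C * (indicator \<Omega> x * \<phi> x))"
    using X0_set_integrable[OF assms(3) \<Omega>] by (simp add: set_integrable_def)
  show "(\<lambda>x. indicator \<Omega> x * (b x * \<phi> x)) \<in> borel_measurable lborel" by measurable
  show "AE x in lborel. norm (indicator \<Omega> x * (b x * \<phi> x)) \<le> norm (C * (indicator \<Omega> x * \<phi> x))"
    using assms(2) \<open>0 \<le> C\<close> by (auto simp: indicator_def abs_mult intro!: mult_right_mono)
qed

text \<open>Collects what the minimization requires of a frozen nonlinearity: \<open>low\<close> and
  \<open>high\<close> are the sign conditions that make clamping favourable, and
  \<open>bound\<close> makes the primitive Lipschitz.\<close>

locale truncated_nonlinearity =
  fixes h H :: "real \<Rightarrow> real" and T C :: real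
  assumes cont: "continuous_on UNIV h"
    and deriv: "\<And>t. (H has_real_derivative h t) (at t)"
    and H0: "H 0 = 0"
    and bound: "\<And>t. \<bar>h t\<bar> \<le> C"
    and low: "\<And>t. t \<le> 0 \<Longrightarrow> h t = 0"
    and high: "\<And>t. T \<le> t \<Longrightarrow> h t \<le> 0"
    and T_pos: "0 < T"
begin

lemma C_nonneg: "0 \<le> C" using bound[of 0] by linarith

lemma H_lipschitz: "\<bar>H a - H b\<bar> \<le> C * \<bar>a - b\<bar>"
  using field_differentiable_bound[of UNIV H h C a b] deriv bound by auto

lemma H_bound: "\<bar>H t\<bar> \<le> C * \<bar>t\<bar>"
  using H_lipschitz[of t 0] H0 by simp

lemma H_measurable [measurable]: "H \<in> borel_measurable borel"
  by (intro borel_measurable_continuous_onI DERIV_continuous_on[of UNIV H h]) (auto intro: deriv)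

lemma h_measurable [measurable]: "h \<in> borel_measurable borel"
  by (intro borel_measurable_continuous_onI cont)

text \<open>To the left of 0 the primitive is constant, to the right of T it is nonincreasing, so
  moving to the nearest point of [0,T] never lowers it.\<close>

lemma H_le_clamp: "H t \<le> H (clamp_to T t)"
proof -
  consider "t \<le> 0" | "0 \<le> t" "t \<le> T" | "T \<le> t" by linarith
  then show ?thesis
  proof cases
    case 1
    have "H 0 \<ge> H t"
      by (rule DERIV_nonneg_imp_nondecreasing[OF 1]) (use deriv low in force)
    with 1 T_pos show ?thesis by (simp add: clamp_to_def)
  next
    case 3
    have "H t \<le> H T"
      by (rule DERIV_nonpos_imp_nonincreasing[OF 3]) (use deriv high in force)
    with 3 T_pos show ?thesis by (simp add: clamp_to_def)
  qed (simp add: clamp_to_def)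
qed

lemma H_clamp_bound: "\<bar>H (clamp_to T t)\<bar> \<le> C * T"
proof -
  have "C * \<bar>clamp_to T t\<bar> \<le> C * T"
    using C_nonneg T_pos by (intro mult_left_mono) (auto simp: clamp_to_def)
  with H_bound[of "clamp_to T t"] show ?thesis by linarith
qed

section \<open>Direct method and Euler-Lagrange equation\<close>

context
  fixes \<Omega> :: "(real^'n) set" and s :: real
  assumes \<Omega>: "open \<Omega>" "bounded \<Omega>" and s: "0 < s"
begin

lemma integrable_H:
  assumes "v \<in> X0 s \<Omega>"
  shows "integrable lborel (\<lambda>x. indicator \<Omega> x * H (v x))"
proof (rule Bochner_Integration.integrable_bound)
  have [measurable]: "v \<in> borel_measurable borel" "\<Omega> \<in> sets borel" using assms \<Omega> by (auto simp: X0_iff)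
  show "integrable lborel (\<lambda>x. C * (indicator \<Omega> x * v x))"
    using X0_set_integrable[OF assms \<Omega>] by (simp add: set_integrable_def)
  show "(\<lambda>x. indicator \<Omega> x * H (v x)) \<in> borel_measurable lborel" by measurable
  show "AE x in lborel. norm (indicator \<Omega> x * H (v x)) \<le> norm (C * (indicator \<Omega> x * v x))"
    using H_bound C_nonneg by (auto simp: indicator_def abs_mult)
qed

lemma clamp_in_X0: "v \<in> X0 s \<Omega> \<Longrightarrow> (\<lambda>x. clamp_to T (v x)) \<in> X0 s \<Omega>"
  by (rule X0_contraction(1)[of _ _ _ "clamp_to T"]) (auto simp: clamp_to_contraction, auto simp: clamp_to_def T_pos less_imp_le)

lemma energy_clamp_le:
  assumes v: "v \<in> X0 s \<Omega>"
  shows "energy s \<Omega> H (\<lambda>x. clamp_to T (v x)) \<le> energy s \<Omega> H v"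
proof -
  have "gagliardo_form s (\<lambda>x. clamp_to T (v x)) (\<lambda>x. clamp_to T (v x)) \<le> gagliardo_form s v v"
    by (rule X0_contraction(2)[OF v, of "clamp_to T"]) (auto simp: clamp_to_contraction, auto simp: clamp_to_def T_pos less_imp_le)
  moreover have "(\<integral>x. indicator \<Omega> x * H (v x) \<partial>lborel) \<le> (\<integral>x. indicator \<Omega> x * H (clamp_to T (v x)) \<partial>lborel)"
    by (rule integral_mono[OF integrable_H[OF v] integrable_H[OF clamp_in_X0[OF v]]])
       (auto simp: indicator_def H_le_clamp)
  ultimately show ?thesis unfolding energy_def by linarith
qed

lemma integral_H_clamp_bound:
  assumes v: "v \<in> X0 s \<Omega>"
  shows "(\<integral>x. indicator \<Omega> x * H (clamp_to T (v x)) \<partial>lborel) \<le> C * T * measure lborel \<Omega>"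
proof -
  have "(\<integral>x. indicator \<Omega> x * H (clamp_to T (v x)) \<partial>lborel) \<le> (\<integral>x. indicator \<Omega> x * (C * T) \<partial>lborel)"
  proof (rule integral_mono[OF integrable_H[OF clamp_in_X0[OF v]]])
    show "integrable lborel (\<lambda>x. indicat_real \<Omega> x * (C * T))"
      by (rule integrable_indicator_bounded[OF \<Omega>]) auto
    show "indicat_real \<Omega> x * H (clamp_to T (v x)) \<le> indicat_real \<Omega> x * (C * T)" for x
      using abs_le_D1[OF H_clamp_bound[of "v x"]] by (simp add: indicator_def)
  qed
  also have "\<dots> = C * T * measure lborel \<Omega>" by simp
  finally show ?thesis .
qed

lemma energy_minimizer_exists:
  obtains u where "u \<in> X0 s \<Omega>" "\<And>x. 0 \<le> u x" "\<And>x. u x \<le> T" "\<And>v. v \<in> X0 s \<Omega> \<Longrightarrow> energy s \<Omega> H u \<le> energy s \<Omega> H v"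
proof -
  define A where "A = C * T * measure lborel \<Omega>"
  define I where "I = (INF v\<in>X0 s \<Omega>. energy s \<Omega> H v)"
  \<comment> \<open>The potential of a clamped function is at most A, so the energy alone controls
    its Gagliardo form. This gives both boundedness below and the bound for the compactness
    lemma.\<close>
  have gb: "gagliardo_form s (\<lambda>x. clamp_to T (v x)) (\<lambda>x. clamp_to T (v x)) \<le> 2 * (energy s \<Omega> H v + A)"
    if "v \<in> X0 s \<Omega>" for v
    using energy_clamp_le[OF that] integral_H_clamp_bound[OF that] unfolding energy_def A_def by argo
  have bdd: "bdd_below (energy s \<Omega> H ` X0 s \<Omega>)"
  proof (rule bdd_belowI2)
    show "- A \<le> energy s \<Omega> H v" if "v \<in> X0 s \<Omega>" for v
      using gb[OF that] gagliardo_form_self_nonneg[of s "\<lambda>x. clamp_to T (v x)"] by argo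
  qed
  have Ile: "I \<le> energy s \<Omega> H v" if "v \<in> X0 s \<Omega>" for v
    unfolding I_def using bdd that by (rule cINF_lower)
  have "\<exists>v\<in>X0 s \<Omega>. energy s \<Omega> H v < I + 1 / (real n + 1)" for n
  proof (rule ccontr)
    assume "\<not> ?thesis"
    then have "I + 1 / (real n + 1) \<le> I"
      unfolding I_def[of] by (intro cINF_greatest) (use zero_in_X0 I_def in force)+
    then show False by (simp add: field_simps)
  qed
  then obtain v where v: "\<And>n. v n \<in> X0 s \<Omega>" and vI: "\<And>n. energy s \<Omega> H (v n) < I + 1 / (real n + 1)"
    by metis
  define un where "un n x = clamp_to T (v n x)" for n x
  have un: "un n \<in> X0 s \<Omega>" for n unfolding un_def using clamp_in_X0[OF v] .
  have un0: "0 \<le> un n x" "un n x \<le> T" for n x using T_pos by (auto simp: un_def clamp_to_def)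
  have unI: "energy s \<Omega> H (un n) \<le> I + 1 / (real n + 1)" for n
    unfolding un_def using energy_clamp_le[OF v[of n]] vI[of n] by linarith
  have ub: "gagliardo_form s (un n) (un n) \<le> 2 * (I + 1 + A)" for n
  proof -
    have "1 / (real n + 1) \<le> 1" by simp
    then show ?thesis using gb[OF v[of n]] vI[of n] unfolding un_def by argo
  qed
  obtain r where r: "strict_mono r" "AE x in lborel. convergent (\<lambda>n. un (r n) x)"
    by (rule X0_AE_convergent_subsequence[OF un _ ub s \<Omega>, where M=T]) (use un0 in auto)
  \<comment> \<open>Where the sequence diverges, \<open>lim\<close> is an unspecified value; the
    outer clamp makes the bounds 0 and T hold at every point and changes nothing where it
    converges.\<close>
  define u where "u x = clamp_to T (lim (\<lambda>n. un (r n) x))" for x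
  have unm [measurable]: "un n \<in> borel_measurable borel" for n using un by (auto simp: X0_iff)
  have \<Omega>m [measurable]: "\<Omega> \<in> sets borel" using \<Omega> by auto
  have um [measurable]: "u \<in> borel_measurable borel" unfolding u_def by measurable
  have u0: "0 \<le> u x" "u x \<le> T" for x using T_pos by (auto simp: u_def clamp_to_def)
  have lim: "AE x in lborel. (\<lambda>n. un (r n) x) \<longlonglongrightarrow> u x"
    using r(2)
  proof eventually_elim
    case (elim x)
    then have "(\<lambda>n. un (r n) x) \<longlonglongrightarrow> lim (\<lambda>n. un (r n) x)" by (simp add: convergent_LIMSEQ_iff)
    then have "(\<lambda>n. clamp_to T (un (r n) x)) \<longlonglongrightarrow> u x"
      unfolding u_def clamp_to_def by (intro tendsto_intros)
    moreover have "clamp_to T (un (r n) x) = un (r n) x" for n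
      using un0[of "r n" x] T_pos by (simp add: clamp_to_def)
    ultimately show ?case by simp
  qed
  have "AE x in lborel. \<forall>n. x \<notin> \<Omega> \<longrightarrow> un n x = 0"
    unfolding AE_all_countable using un by (auto simp: X0_iff)
  with lim have uout: "AE x in lborel. x \<notin> \<Omega> \<longrightarrow> u x = 0"
  proof eventually_elim
    case (elim x)
    then show ?case using LIMSEQ_unique[of "\<lambda>n. un (r n) x" "u x" 0] by auto
  qed
  have sq: "integrable lborel (\<lambda>x. (u x)\<^sup>2)"
  proof (rule Bochner_Integration.integrable_bound)
    show "integrable lborel (\<lambda>x. indicat_real \<Omega> x * T\<^sup>2)"
      by (rule integrable_indicator_bounded[OF \<Omega>]) auto
    show "AE x in lborel. norm ((u x)\<^sup>2) \<le> norm (indicat_real \<Omega> x * T\<^sup>2)"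
      using uout by eventually_elim (use u0 in \<open>auto simp: indicator_def intro!: power_mono\<close>)
  qed measurable
  have HI: "(\<lambda>n. \<integral>x. indicator \<Omega> x * H (un (r n) x) \<partial>lborel) \<longlonglongrightarrow> (\<integral>x. indicator \<Omega> x * H (u x) \<partial>lborel)"
  proof (rule integral_dominated_convergence[where w="\<lambda>x. indicator \<Omega> x * (C * T)"])
    show "integrable lborel (\<lambda>x. indicat_real \<Omega> x * (C * T))"
      by (rule integrable_indicator_bounded[OF \<Omega>]) auto
    show "AE x in lborel. (\<lambda>n. indicat_real \<Omega> x * H (un (r n) x)) \<longlonglongrightarrow> indicat_real \<Omega> x * H (u x)"
      using lim
    proof eventually_elim
      case (elim x)
      then show ?case
        by (intro tendsto_mult tendsto_const isCont_tendsto_compose[OF DERIV_isCont[OF deriv]])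
    qed
    have "norm (indicat_real \<Omega> x * H (un n x)) \<le> indicat_real \<Omega> x * (C * T)" for n x
      using H_clamp_bound[of "v n x"] by (simp add: indicator_def un_def)
    then show "AE x in lborel. norm (indicat_real \<Omega> x * H (un (r n) x)) \<le> indicat_real \<Omega> x * (C * T)" for n
      by auto
  qed measurable
  have EI: "(\<lambda>n. energy s \<Omega> H (un (r n))) \<longlonglongrightarrow> I"
  proof (rule tendsto_sandwich[where f="\<lambda>_. I" and h="\<lambda>n. I + 1 / (real (r n) + 1)"])
    have "(\<lambda>n. I + 1 / (real n + 1)) \<longlonglongrightarrow> I + 0"
      by (intro tendsto_add tendsto_const) real_asymp
    then show "(\<lambda>n. I + 1 / (real (r n) + 1)) \<longlonglongrightarrow> I"
      using LIMSEQ_subseq_LIMSEQ[OF _ r(1)] by (fastforce simp: o_def)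
  qed (use Ile un unI in auto)
  \<comment> \<open>Energies and potentials both converge, hence so do the Gagliardo forms; lower
    semicontinuity against this limit says exactly that u has energy at most I.\<close>
  have "(\<lambda>n. 2 * (energy s \<Omega> H (un (r n)) + (\<integral>x. indicator \<Omega> x * H (un (r n) x) \<partial>lborel)))
     \<longlonglongrightarrow> 2 * (I + (\<integral>x. indicator \<Omega> x * H (u x) \<partial>lborel))"
    by (intro tendsto_mult tendsto_add tendsto_const EI HI)
  then have G: "(\<lambda>n. gagliardo_form s (un (r n)) (un (r n))) \<longlonglongrightarrow> 2 * (I + (\<integral>x. indicator \<Omega> x * H (u x) \<partial>lborel))"
    by (simp add: energy_def)
  note lsc = gagliardo_lower_semicontinuous[of "\<lambda>n. un (r n)", OF un um lim sq G]
  show thesis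
  proof (rule that[of u])
    show "u \<in> X0 s \<Omega>" by (rule lsc(1))
    have "energy s \<Omega> H u \<le> I" using lsc(2) unfolding energy_def by argo
    then show "energy s \<Omega> H u \<le> energy s \<Omega> H v" if "v \<in> X0 s \<Omega>" for v
      using Ile[OF that] by linarith
  qed (use u0 in auto)
qed

text \<open>Difference quotients along positive steps suffice: they give one inequality for every
  test function, and \<open>euler_lagrange\<close> obtains the other by testing with - phi. The
  Lipschitz bound on H dominates the quotients by C |phi|, and the quadratic term carries a factor
  \<open>c n\<close> that vanishes.\<close>

lemma energy_variation_le:
  assumes u: "u \<in> X0 s \<Omega>" and min: "\<And>v. v \<in> X0 s \<Omega> \<Longrightarrow> energy s \<Omega> H u \<le> energy s \<Omega> H v"
    and \<phi>: "\<phi> \<in> X0 s \<Omega>"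
  shows "(\<integral>x. indicator \<Omega> x * (h (u x) * \<phi> x) \<partial>lborel) \<le> gagliardo_form s u \<phi>"
proof -
  have [measurable]: "u \<in> borel_measurable borel" "\<phi> \<in> borel_measurable borel" "\<Omega> \<in> sets borel"
    using u \<phi> \<Omega> by (auto simp: X0_iff)
  define c where "c n = 1 / (real n + 1)" for n
  have c0: "c n > 0" for n by (simp add: c_def)
  have clim: "c \<longlonglongrightarrow> 0" unfolding c_def[abs_def] by real_asymp
  let ?q = "\<lambda>n x. (H (u x + c n * \<phi> x) - H (u x)) / c n"
  have L: "(\<lambda>n. \<integral>x. indicator \<Omega> x * ?q n x \<partial>lborel) \<longlonglongrightarrow> (\<integral>x. indicator \<Omega> x * (h (u x) * \<phi> x) \<partial>lborel)"
  proof (rule integral_dominated_convergence[where w="\<lambda>x. C * \<bar>indicator \<Omega> x * \<phi> x\<bar>"])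
    show "integrable lborel (\<lambda>x. C * \<bar>indicator \<Omega> x * \<phi> x\<bar>)"
      using X0_set_integrable[OF \<phi> \<Omega>] by (intro integrable_mult_right integrable_abs) (simp add: set_integrable_def)
    show "AE x in lborel. (\<lambda>n. indicat_real \<Omega> x * ?q n x) \<longlonglongrightarrow> indicat_real \<Omega> x * (h (u x) * \<phi> x)"
    proof (intro AE_I2 tendsto_mult tendsto_const)
      fix x
      have "((\<lambda>e. H (u x + e * \<phi> x)) has_real_derivative h (u x) * \<phi> x) (at 0)"
        by (rule DERIV_chain2[where f=H]) (auto intro!: deriv derivative_eq_intros)
      then have "((\<lambda>e. (H (u x + e * \<phi> x) - H (u x)) / e) \<longlongrightarrow> h (u x) * \<phi> x) (at 0)"
        by (simp add: DERIV_def)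
      moreover have "filterlim c (at 0) sequentially"
        unfolding filterlim_at using clim c0 by (auto simp: less_imp_neq[THEN not_sym])
      ultimately show "(\<lambda>n. ?q n x) \<longlonglongrightarrow> h (u x) * \<phi> x"
        by (rule filterlim_compose)
    qed
    have "norm (indicat_real \<Omega> x * ?q n x) \<le> C * \<bar>indicator \<Omega> x * \<phi> x\<bar>" for n x
    proof -
      have "\<bar>H (u x + c n * \<phi> x) - H (u x)\<bar> \<le> C * (c n * \<bar>\<phi> x\<bar>)"
        using H_lipschitz[of "u x + c n * \<phi> x" "u x"] c0[of n] by (simp add: abs_mult)
      then have "\<bar>?q n x\<bar> \<le> C * \<bar>\<phi> x\<bar>"
        using c0[of n] by (simp add: field_simps)
      then show ?thesis by (simp add: indicator_def)
    qed
    then show "AE x in lborel. norm (indicat_real \<Omega> x * ?q n x) \<le> C * \<bar>indicator \<Omega> x * \<phi> x\<bar>" for n by auto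
  qed measurable
  have le: "(\<integral>x. indicator \<Omega> x * ?q n x \<partial>lborel) \<le> gagliardo_form s u \<phi> + c n / 2 * gagliardo_form s \<phi> \<phi>" for n
  proof -
    have v: "(\<lambda>x. u x + c n * \<phi> x) \<in> X0 s \<Omega>" by (rule X0_add_scale[OF u \<phi>])
    have "(\<integral>x. indicator \<Omega> x * ?q n x \<partial>lborel) =
      (\<integral>x. (indicator \<Omega> x * H (u x + c n * \<phi> x) - indicator \<Omega> x * H (u x)) / c n \<partial>lborel)"
      by (intro Bochner_Integration.integral_cong) (auto simp: right_diff_distrib)
    also have "\<dots> = ((\<integral>x. indicator \<Omega> x * H (u x + c n * \<phi> x) \<partial>lborel) - (\<integral>x. indicator \<Omega> x * H (u x) \<partial>lborel)) / c n"
      using integrable_H[OF u] integrable_H[OF v] by simp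
    also have "\<dots> \<le> (c n * gagliardo_form s u \<phi> + (c n)\<^sup>2 / 2 * gagliardo_form s \<phi> \<phi>) / c n"
      using min[OF v] c0[of n] unfolding energy_def gagliardo_form_add_scale[OF u \<phi>]
      by (intro divide_right_mono) (simp_all add: field_simps)
    also have "\<dots> = gagliardo_form s u \<phi> + c n / 2 * gagliardo_form s \<phi> \<phi>"
      using c0[of n] by (simp add: field_simps power2_eq_square)
    finally show ?thesis .
  qed
  have "(\<lambda>n. gagliardo_form s u \<phi> + c n / 2 * gagliardo_form s \<phi> \<phi>) \<longlonglongrightarrow> gagliardo_form s u \<phi> + 0 / 2 * gagliardo_form s \<phi> \<phi>"
    by (intro tendsto_intros clim) auto
  from LIMSEQ_le[OF L this] le show ?thesis by auto
qed

lemma euler_lagrange: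
  assumes u: "u \<in> X0 s \<Omega>" and min: "\<And>v. v \<in> X0 s \<Omega> \<Longrightarrow> energy s \<Omega> H u \<le> energy s \<Omega> H v"
    and \<phi>: "\<phi> \<in> X0 s \<Omega>"
  shows "gagliardo_form s u \<phi> = (\<integral>x. indicator \<Omega> x * (h (u x) * \<phi> x) \<partial>lborel)"
proof (rule antisym)
  have "(\<lambda>x. - \<phi> x) \<in> X0 s \<Omega>"
    using X0_add_scale[OF zero_in_X0 \<phi>, of "-1"] by simp
  from energy_variation_le[OF u min this]
  have "- (\<integral>x. indicator \<Omega> x * (h (u x) * \<phi> x) \<partial>lborel) \<le> gagliardo_form s u (\<lambda>x. - \<phi> x)"
    by simp
  also have "gagliardo_form s u (\<lambda>x. - \<phi> x) = - gagliardo_form s u \<phi>"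
    unfolding gagliardo_form_def integral_minus[symmetric]
    by (intro Bochner_Integration.integral_cong) (auto simp: minus_divide_left algebra_simps)
  finally show "gagliardo_form s u \<phi> \<le> (\<integral>x. indicator \<Omega> x * (h (u x) * \<phi> x) \<partial>lborel)" by simp
qed (rule energy_variation_le[OF u min \<phi>])

end

end

section \<open>Lipschitz cutoffs have finite energy\<close>

text \<open>Up to a constant this majorizes, as a function of the difference of the two points, the
  density of any bounded Lipschitz function: the square wins near 0, the constant 1 far
  away.\<close>

definition levy_kernel :: "real \<Rightarrow> real^'n \<Rightarrow> real" where
  "levy_kernel s h = min 1 ((norm h)\<^sup>2) / norm h powr (real CARD('n) + 2 * s)"

lemma levy_kernel_nonneg [simp]: "0 \<le> levy_kernel s h"
  by (simp add: levy_kernel_def)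

lemma borel_measurable_levy_kernel [measurable]: "levy_kernel s \<in> borel_measurable borel"
  unfolding levy_kernel_def[abs_def] by measurable

lemma dyadic_bracket:
  fixes r :: real
  assumes "1 \<le> r"
  obtains k :: nat where "2 ^ k \<le> r" "r \<le> 2 ^ Suc k"
proof -
  define k where "k = nat \<lfloor>log 2 r\<rfloor>"
  have "0 \<le> log 2 r" using assms by simp
  then have "\<lfloor>log 2 r\<rfloor> = int k" by (simp add: k_def)
  then have "2 powr real k \<le> r" "r < 2 powr (real k + 1)"
    using assms floor_log_eq_powr_iff[of r 2 "int k"] by auto
  moreover have "2 powr (real k + 1) = 2 ^ Suc k" by (simp add: powr_add powr_realpow)
  ultimately show thesis using that[of k] by (simp add: powr_realpow)
qed

text \<open>
  The kernel is dominated by a constant on each dyadic shell; the shell integrals form geometric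
  series with ratios $2^{2s-2}$ near the origin and $2^{-2s}$ near infinity.
\<close>

lemma levy_kernel_integral_finite:
  assumes "0 < s" "s < 1"
  shows "(\<integral>\<^sup>+h. levy_kernel s (h :: real^'n) \<partial>lborel) < \<infinity>"
proof -
  let ?N = "real CARD('n)"
  define q where "q = 2 powr (?N + 2 * s)"
  define V where "V = unit_ball_vol ?N"
  have "0 < q" by (simp add: q_def)
  have "0 \<le> V" by (simp add: V_def unit_ball_vol_nonneg)
  have pw: "(2 ^ k) powr (?N + 2 * s) = q ^ k" for k :: nat
    unfolding q_def by (simp add: powr_power powr_realpow[symmetric] powr_powr mult.commute)
  \<comment> \<open>For norm h between 2^-(k+1) and 2^-k the numerator is at most 4^-k and the
    denominator at least q^-(k+1), which gives \<open>a k\<close>; for norm h between 2^k and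
    2^(k+1) the kernel is at most \<open>b k\<close>. Full balls replace the shells since their
    volume has the same order.\<close>
  define a b where "a k = (1 / 4) ^ k * q ^ Suc k" and "b k = (1 / q) ^ k" for k :: nat
  define A B :: "nat \<Rightarrow> (real^'n) set" where "A k = cball 0 (1 / 2 ^ k)" and "B k = cball 0 (2 ^ Suc k)" for k
  have a0: "0 \<le> a k" "0 \<le> b k" for k using \<open>0 < q\<close> by (auto simp: a_def b_def)
  have [measurable]: "A k \<in> sets borel" "B k \<in> sets borel" for k by (auto simp: A_def B_def)
  have pt: "ennreal (levy_kernel s h) \<le> (\<Sum>k. ennreal (a k) * indicator (A k) h + ennreal (b k) * indicator (B k) h)" for h :: "real^'n"
  proof (cases "h = 0")
    case False
    let ?t = "\<lambda>k. ennreal (a k) * indicator (A k) h + ennreal (b k) * indicator (B k) h"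
    have sum: "?t k \<le> suminf ?t" for k
      using sum_le_suminf[of ?t "{k}"] by simp
    show ?thesis
    proof (cases "norm h < 1")
      case True
      have "1 \<le> 1 / norm h" using True False by simp
      then obtain k where k: "2 ^ k \<le> 1 / norm h" "1 / norm h \<le> 2 ^ Suc k" by (rule dyadic_bracket)
      have hk: "norm h \<le> 1 / 2 ^ k" "1 / 2 ^ Suc k \<le> norm h"
        using k False by (simp_all add: field_simps)
      have "(norm h)\<^sup>2 \<le> (1 / 2 ^ k)\<^sup>2" by (rule power_mono[OF hk(1)]) simp
      also have "(1 / 2 ^ k)\<^sup>2 = (1 / 4 :: real) ^ k"
        by (simp add: power_divide power2_eq_square power_mult_distrib[symmetric])
      finally have n: "min 1 ((norm h)\<^sup>2) \<le> (1 / 4) ^ k" by simp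
      have "(1 / 2 ^ Suc k) powr (?N + 2 * s) \<le> norm h powr (?N + 2 * s)"
        by (rule powr_mono2) (use hk \<open>0 < s\<close> in auto)
      moreover have "(1 / 2 ^ Suc k) powr (?N + 2 * s) = 1 / q ^ Suc k"
        using pw[of "Suc k"] by (simp add: powr_divide)
      ultimately have "1 / q ^ Suc k \<le> norm h powr (?N + 2 * s)" by simp
      with n have "levy_kernel s h \<le> (1 / 4) ^ k / (1 / q ^ Suc k)"
        unfolding levy_kernel_def using \<open>0 < q\<close> by (intro frac_le) auto
      then have "ennreal (levy_kernel s h) \<le> ennreal (a k)"
        by (intro ennreal_leI) (simp add: a_def)
      also have "\<dots> \<le> ?t k" using hk by (simp add: A_def)
      finally show ?thesis using sum[of k] by (rule order_trans)
    next
      case False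
      then have "1 \<le> norm h" by simp
      then obtain k where k: "2 ^ k \<le> norm h" "norm h \<le> 2 ^ Suc k" by (rule dyadic_bracket)
      have "(2 ^ k) powr (?N + 2 * s) \<le> norm h powr (?N + 2 * s)"
        by (rule powr_mono2) (use k \<open>0 < s\<close> in auto)
      then have "levy_kernel s h \<le> 1 / q ^ k"
        unfolding levy_kernel_def pw using \<open>0 < q\<close> by (intro frac_le) auto
      then have "ennreal (levy_kernel s h) \<le> ennreal (b k)"
        by (intro ennreal_leI) (simp add: b_def power_divide)
      also have "\<dots> \<le> ?t k" using k by (simp add: B_def)
      finally show ?thesis using sum[of k] by (rule order_trans)
    qed
  qed (simp add: levy_kernel_def)
  have qN: "q = 2 ^ CARD('n) * 2 powr (2 * s)"
    by (simp add: q_def powr_add powr_realpow)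
  have fa: "a k * (V * (1 / 2 ^ k) ^ CARD('n)) = q * V * (2 powr (2 * s) / 4) ^ k" for k
  proof -
    have "((1 :: real) / 2 ^ k) ^ CARD('n) = (1 / 2 ^ CARD('n)) ^ k"
      by (simp add: power_divide power_mult[symmetric] mult.commute)
    then show ?thesis by (simp add: a_def qN power_mult_distrib power_divide)
  qed
  have fb: "b k * (V * (2 ^ Suc k) ^ CARD('n)) = 2 ^ CARD('n) * V * (1 / 2 powr (2 * s)) ^ k" for k
  proof -
    have "((2 :: real) ^ Suc k) ^ CARD('n) = 2 ^ CARD('n) * (2 ^ CARD('n)) ^ k"
      by (simp add: power_mult_distrib power_mult[symmetric] mult.commute)
    then show ?thesis by (simp add: b_def qN power_mult_distrib power_divide)
  qed
  have "2 powr (2 * s) < 2 powr 2" using \<open>s < 1\<close> by (intro powr_less_mono) auto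
  then have "2 powr (2 * s) / 4 < 1" by (simp add: powr_numeral)
  moreover have "1 / 2 powr (2 * s) < 1" using \<open>0 < s\<close> by simp
  ultimately have summ: "summable (\<lambda>k. q * V * (2 powr (2 * s) / 4) ^ k + 2 ^ CARD('n) * V * (1 / 2 powr (2 * s)) ^ k)"
    by (intro summable_add summable_mult summable_geometric) auto
  have "(\<integral>\<^sup>+h. levy_kernel s (h :: real^'n) \<partial>lborel)
     \<le> (\<integral>\<^sup>+h. (\<Sum>k. ennreal (a k) * indicator (A k) h + ennreal (b k) * indicator (B k) h) \<partial>lborel)"
    by (rule nn_integral_mono) (rule pt)
  also have "\<dots> = (\<Sum>k. \<integral>\<^sup>+h. ennreal (a k) * indicator (A k) h + ennreal (b k) * indicator (B k) h \<partial>lborel)"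
    by (rule nn_integral_suminf) measurable
  also have "\<dots> = (\<Sum>k. ennreal (q * V * (2 powr (2 * s) / 4) ^ k + 2 ^ CARD('n) * V * (1 / 2 powr (2 * s)) ^ k))"
  proof (rule suminf_cong)
    fix k
    have "(\<integral>\<^sup>+h. ennreal (a k) * indicator (A k) h + ennreal (b k) * indicator (B k) h \<partial>lborel)
      = ennreal (a k) * emeasure lborel (A k) + ennreal (b k) * emeasure lborel (B k)"
      by (subst nn_integral_add) (auto simp: nn_integral_cmult_indicator)
    also have "emeasure lborel (A k) = ennreal (V * (1 / 2 ^ k) ^ CARD('n))"
      unfolding A_def V_def by (simp add: emeasure_cball)
    also have "emeasure lborel (B k) = ennreal (V * (2 ^ Suc k) ^ CARD('n))"
      unfolding B_def V_def by (subst emeasure_cball) auto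
    also have "ennreal (a k) * ennreal (V * (1 / 2 ^ k) ^ CARD('n)) + ennreal (b k) * ennreal (V * (2 ^ Suc k) ^ CARD('n))
      = ennreal (a k * (V * (1 / 2 ^ k) ^ CARD('n)) + b k * (V * (2 ^ Suc k) ^ CARD('n)))"
      using a0 \<open>0 \<le> V\<close> by (simp add: ennreal_mult[symmetric] ennreal_plus[symmetric] del: ennreal_plus)
    finally show "(\<integral>\<^sup>+h. ennreal (a k) * indicator (A k) h + ennreal (b k) * indicator (B k) h \<partial>lborel)
      = ennreal (q * V * (2 powr (2 * s) / 4) ^ k + 2 ^ CARD('n) * V * (1 / 2 powr (2 * s)) ^ k)"
      unfolding fa fb .
  qed
  also have "\<dots> < \<infinity>"
    using ennreal_suminf_neq_top[OF summ] \<open>0 < q\<close> \<open>0 \<le> V\<close> by (simp add: less_top)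
  finally show ?thesis .
qed

lemma nn_integral_levy_kernel_translate:
  "(\<integral>\<^sup>+y. levy_kernel s (y - x) \<partial>lborel) = (\<integral>\<^sup>+h. levy_kernel s (h :: real^'n) \<partial>lborel)"
  for x :: "real^'n"
proof -
  have "(\<integral>\<^sup>+h. levy_kernel s (h :: real^'n) \<partial>lborel) = (\<integral>\<^sup>+h. levy_kernel s h \<partial>(distr lborel borel ((+) (- x))))"
    by (simp add: lborel_distr_plus)
  also have "\<dots> = (\<integral>\<^sup>+y. levy_kernel s (y - x) \<partial>lborel)"
    by (subst nn_integral_distr) auto
  finally show ?thesis by simp
qed

text \<open>A tent function works: its density vanishes when both points lie outside the supporting
  ball B, so it is bounded by Levy kernels anchored at a point of B. By translation invariance each
  of them integrates to |B| times the kernel integral.\<close>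

lemma X0_cutoff:
  fixes \<Omega> :: "(real^'n) set"
  assumes s: "0 < s" "s < 1" and "open \<Omega>" "\<Omega> \<noteq> {}"
  obtains \<psi> x0 r where "\<psi> \<in> X0 s \<Omega>" "\<And>x. 0 \<le> \<psi> x" "\<And>x. \<psi> x \<le> 1"
    "0 < r" "ball x0 r \<subseteq> \<Omega>" "\<And>x. x \<in> ball x0 r \<Longrightarrow> \<psi> x = 1"
proof -
  obtain x0 where "x0 \<in> \<Omega>" using \<open>\<Omega> \<noteq> {}\<close> by blast
  then obtain R where "0 < R" and R: "ball x0 R \<subseteq> \<Omega>"
    using \<open>open \<Omega>\<close> open_contains_ball by blast
  define r where "r = R / 2"
  have "0 < r" using \<open>0 < R\<close> by (simp add: r_def)
  \<comment> \<open>Slope 1/r between the radii r and R = 2r, capped at 1 inside and at 0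
    outside.\<close>
  define \<psi> :: "real^'n \<Rightarrow> real" where "\<psi> x = max 0 (min 1 (2 - dist x x0 / r))" for x
  define B where "B = ball x0 R"
  have [measurable]: "B \<in> sets borel" by (simp add: B_def)
  have [measurable]: "\<psi> \<in> borel_measurable borel" unfolding \<psi>_def[abs_def] by measurable
  have \<psi>01: "0 \<le> \<psi> x" "\<psi> x \<le> 1" for x by (auto simp: \<psi>_def)
  have \<psi>out: "\<psi> x = 0" if "x \<notin> B" for x
    using that \<open>0 < r\<close> by (auto simp: \<psi>_def B_def r_def field_simps dist_commute)
  have lip: "\<bar>\<psi> x - \<psi> y\<bar> \<le> norm (y - x) / r" for x y
  proof -
    have "\<bar>\<psi> x - \<psi> y\<bar> \<le> \<bar>dist x x0 / r - dist y x0 / r\<bar>"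
      unfolding \<psi>_def by (auto simp: max_def min_def)
    also have "\<dots> = \<bar>dist x x0 - dist y x0\<bar> / r"
      using \<open>0 < r\<close> by (simp add: diff_divide_distrib[symmetric])
    also have "\<bar>dist x x0 - dist y x0\<bar> \<le> dist x y"
      using abs_dist_diff_le[of x x0 y] by (simp add: dist_commute)
    finally show ?thesis using \<open>0 < r\<close> by (simp add: divide_right_mono dist_norm norm_minus_commute)
  qed
  \<comment> \<open>One constant absorbs both the bound 1 on differences and the squared Lipschitz
    constant 1/r^2.\<close>
  define Q where "Q = max 1 (1 / r\<^sup>2)"
  have "1 \<le> Q" "1 / r\<^sup>2 \<le> Q" by (auto simp: Q_def)
  have sq: "(\<psi> x - \<psi> y)\<^sup>2 \<le> Q * min 1 ((norm (y - x))\<^sup>2)" for x y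
  proof -
    have "\<bar>\<psi> x - \<psi> y\<bar> \<le> 1" using \<psi>01[of x] \<psi>01[of y] by linarith
    then have 1: "(\<psi> x - \<psi> y)\<^sup>2 \<le> Q"
      using \<open>1 \<le> Q\<close> abs_square_le_1[of "\<psi> x - \<psi> y"] by linarith
    have "(\<psi> x - \<psi> y)\<^sup>2 \<le> (norm (y - x) / r)\<^sup>2"
      using lip[of x y] by (intro power2_le_iff_abs_le[THEN iffD2]) (use \<open>0 < r\<close> in auto)
    also have "\<dots> = 1 / r\<^sup>2 * (norm (y - x))\<^sup>2" by (simp add: power_divide)
    also have "\<dots> \<le> Q * (norm (y - x))\<^sup>2" by (intro mult_right_mono \<open>1 / r\<^sup>2 \<le> Q\<close>) auto
    finally show ?thesis using 1 by (simp add: min_def)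
  qed
  \<comment> \<open>The two summands cover the first and the second point lying in B; if both do,
    the bound is merely doubled.\<close>
  have dens: "ennreal (gagliardo_density s \<psi> (x, y)) \<le>
     ennreal Q * (indicator B x * ennreal (levy_kernel s (y - x)) + indicator B y * ennreal (levy_kernel s (x - y)))" for x y
  proof -
    have "gagliardo_density s \<psi> (x, y) \<le> Q * levy_kernel s (y - x)"
      unfolding gagliardo_density_def levy_kernel_def times_divide_eq_right fst_conv snd_conv
      using sq[of x y] by (simp add: dist_norm norm_minus_commute[of x y] divide_right_mono)
    then have "ennreal (gagliardo_density s \<psi> (x, y)) \<le> ennreal (Q * levy_kernel s (y - x))" by (rule ennreal_leI)
    also have "\<dots> = ennreal Q * ennreal (levy_kernel s (y - x))"
      using \<open>1 \<le> Q\<close> by (simp add: ennreal_mult)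
    finally have le: "ennreal (gagliardo_density s \<psi> (x, y)) \<le> ennreal Q * ennreal (levy_kernel s (y - x))" .
    have sym: "levy_kernel s (x - y) = levy_kernel s (y - x)"
      by (simp add: levy_kernel_def norm_minus_commute)
    consider "x \<in> B" "y \<in> B" | "x \<in> B" "y \<notin> B" | "x \<notin> B" "y \<in> B" | "x \<notin> B" "y \<notin> B" by blast
    then show ?thesis
    proof cases
      case 1
      then show ?thesis
        using le unfolding sym by (simp add: distrib_left add_increasing2)
    next
      case 4
      then show ?thesis using \<psi>out by (simp add: gagliardo_density_def)
    qed (use le sym in simp_all)
  qed
  define I where "I = (\<integral>\<^sup>+h. levy_kernel s (h :: real^'n) \<partial>lborel)"
  have "I < \<infinity>" unfolding I_def by (rule levy_kernel_integral_finite[OF s])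
  have m1: "(\<lambda>z. indicator B (fst z) * ennreal (levy_kernel s (snd z - fst z))) \<in> borel_measurable (lborel \<Otimes>\<^sub>M lborel)"
    and m2: "(\<lambda>z. indicator B (snd z) * ennreal (levy_kernel s (fst z - snd z))) \<in> borel_measurable (lborel \<Otimes>\<^sub>M lborel)"
    unfolding measurable_lborel_pair by measurable
  have B: "emeasure lborel B < \<infinity>"
    unfolding B_def by (rule emeasure_bounded_finite) simp
  have i1: "(\<integral>\<^sup>+z. indicator B (fst z) * ennreal (levy_kernel s (snd z - fst z)) \<partial>(lborel \<Otimes>\<^sub>M lborel)) = I * emeasure lborel B"
  proof -
    have "(\<integral>\<^sup>+z. indicator B (fst z) * ennreal (levy_kernel s (snd z - fst z)) \<partial>(lborel \<Otimes>\<^sub>M lborel))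
      = (\<integral>\<^sup>+x. \<integral>\<^sup>+y. indicator B x * ennreal (levy_kernel s (y - x)) \<partial>lborel \<partial>lborel)"
      by (subst lborel.nn_integral_fst[OF m1, symmetric]) simp
    also have "\<dots> = (\<integral>\<^sup>+x. I * indicator B x \<partial>lborel)"
      by (intro nn_integral_cong) (simp add: nn_integral_cmult nn_integral_levy_kernel_translate I_def mult.commute)
    also have "\<dots> = I * emeasure lborel B" by (simp add: nn_integral_cmult_indicator)
    finally show ?thesis .
  qed
  have i2: "(\<integral>\<^sup>+z. indicator B (snd z) * ennreal (levy_kernel s (fst z - snd z)) \<partial>(lborel \<Otimes>\<^sub>M lborel)) = I * emeasure lborel B"
  proof -
    have "(\<integral>\<^sup>+z. indicator B (snd z) * ennreal (levy_kernel s (fst z - snd z)) \<partial>(lborel \<Otimes>\<^sub>M lborel))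
      = (\<integral>\<^sup>+y. \<integral>\<^sup>+x. indicator B y * ennreal (levy_kernel s (x - y)) \<partial>lborel \<partial>lborel)"
      by (subst lborel_pair.nn_integral_snd[OF m2, symmetric]) simp
    also have "\<dots> = (\<integral>\<^sup>+x. I * indicator B x \<partial>lborel)"
      by (intro nn_integral_cong) (simp add: nn_integral_cmult nn_integral_levy_kernel_translate I_def mult.commute)
    also have "\<dots> = I * emeasure lborel B" by (simp add: nn_integral_cmult_indicator)
    finally show ?thesis .
  qed
  have "(\<integral>\<^sup>+z. gagliardo_density s \<psi> z \<partial>(lborel \<Otimes>\<^sub>M lborel)) \<le>
    (\<integral>\<^sup>+z. ennreal Q * (indicator B (fst z) * ennreal (levy_kernel s (snd z - fst z)) + indicator B (snd z) * ennreal (levy_kernel s (fst z - snd z))) \<partial>(lborel \<Otimes>\<^sub>M lborel))"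
  proof (rule nn_integral_mono)
    fix z :: "(real^'n) \<times> (real^'n)"
    show "ennreal (gagliardo_density s \<psi> z) \<le> ennreal Q * (indicator B (fst z) * ennreal (levy_kernel s (snd z - fst z)) + indicator B (snd z) * ennreal (levy_kernel s (fst z - snd z)))"
      using dens[of "fst z" "snd z"] by simp
  qed
  also have "\<dots> = ennreal Q * (I * emeasure lborel B + I * emeasure lborel B)"
    by (simp add: nn_integral_cmult nn_integral_add m1 m2 i1 i2)
  also have "\<dots> < \<infinity>"
    using \<open>I < \<infinity>\<close> B by (simp add: ennreal_mult_less_top)
  finally have fin: "(\<integral>\<^sup>+z. gagliardo_density s \<psi> z \<partial>(lborel \<Otimes>\<^sub>M lborel)) < \<infinity>" .
  show thesis
  proof (rule that[of \<psi> r x0])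
    show "\<psi> \<in> X0 s \<Omega>" unfolding X0_iff
    proof (intro conjI)
      show "integrable lborel (\<lambda>x. (\<psi> x)\<^sup>2)"
      proof (rule Bochner_Integration.integrable_bound)
        show "integrable lborel (indicat_real B)" by (intro integrable_real_indicator B) auto
        have "norm ((\<psi> x)\<^sup>2) \<le> norm (indicat_real B x)" for x
          using \<psi>01[of x] \<psi>out[of x] by (cases "x \<in> B") (auto simp: power_le_one)
        then show "AE x in lborel. norm ((\<psi> x)\<^sup>2) \<le> norm (indicat_real B x)" by auto
      qed measurable
      show "integrable (lborel \<Otimes>\<^sub>M lborel) (gagliardo_density s \<psi>)"
        by (rule integrableI_nonneg) (use fin in auto)
      show "AE x in lborel. x \<notin> \<Omega> \<longrightarrow> \<psi> x = 0" using R \<psi>out unfolding B_def by (intro AE_I2) blast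
    qed measurable
    show "ball x0 r \<subseteq> \<Omega>" using R \<open>0 < R\<close> by (auto simp: r_def)
    show "\<psi> x = 1" if "x \<in> ball x0 r" for x
      using that \<open>0 < r\<close> by (auto simp: \<psi>_def dist_commute field_simps)
  qed (use \<psi>01 \<open>0 < r\<close> in auto)
qed

section \<open>Multiplicity\<close>

lemma antiderivative_exists:
  fixes g :: "real \<Rightarrow> real"
  assumes "continuous_on UNIV g"
  obtains G where "G 0 = 0" "\<And>t. (G has_real_derivative g t) (at t)"
proof -
  have "\<exists>F. \<forall>x. -\<infinity> < ereal x \<longrightarrow> ereal x < \<infinity> \<longrightarrow> (F has_vector_derivative g x) (at x)"
    by (rule einterval_antiderivative) (use assms in \<open>auto simp: continuous_on_eq_continuous_at\<close>)
  then obtain F where F: "\<And>x. (F has_vector_derivative g x) (at x)" by auto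
  show thesis
    by (rule that[of "\<lambda>t. F t - F 0"])
       (auto intro!: derivative_eq_intros F[folded has_real_derivative_iff_has_vector_derivative])
qed

lemma continuous_bounded_interval:
  fixes g :: "real \<Rightarrow> real"
  assumes "continuous_on UNIV g"
  obtains M where "\<And>t. t \<in> {a..b} \<Longrightarrow> \<bar>g t\<bar> \<le> M"
proof -
  have "bounded (g ` {a..b})"
    by (intro compact_imp_bounded compact_continuous_image continuous_on_subset[OF assms]) auto
  then obtain M where "\<forall>y\<in>g ` {a..b}. norm y \<le> M" unfolding bounded_iff by blast
  then show thesis by (intro that[of M]) auto
qed

text \<open>Scaling a cutoff by tau costs tau^2 G / 2 in the form and at most m (c tau^2 + c') in
  the potential, while the ball where the cutoff is 1 contributes a F(tau). Along suitable tau the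
  last term beats any multiple of tau^2.\<close>

lemma low_energy_function:
  fixes \<Omega> :: "(real^'n) set"
  assumes s: "0 < s" "s < 1" and \<Omega>: "open \<Omega>" "bounded \<Omega>" "\<Omega> \<noteq> {}"
    and F: "continuous_on UNIV F"
    and low: "\<And>t. 0 \<le> t \<Longrightarrow> - c * t\<^sup>2 - c' \<le> F t" and "0 \<le> c" "0 \<le> c'"
    and freq: "\<And>K. \<exists>\<^sub>F t in at_top. K * t\<^sup>2 < F t"
  obtains w \<tau> where "w \<in> X0 s \<Omega>" "\<And>x. 0 \<le> w x" "\<And>x. w x \<le> \<tau>" "energy s \<Omega> F w < B"
proof -
  obtain \<psi> x0 r where \<psi>: "\<psi> \<in> X0 s \<Omega>" "\<And>x. 0 \<le> \<psi> x" "\<And>x. \<psi> x \<le> 1"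
    and r: "0 < r" "ball x0 r \<subseteq> \<Omega>" "\<And>x. x \<in> ball x0 r \<Longrightarrow> \<psi> x = 1"
    using X0_cutoff[OF s \<Omega>(1,3)] by metis
  define G where "G = gagliardo_form s \<psi> \<psi>"
  define m where "m = measure lborel \<Omega>"
  define a where "a = measure lborel (ball x0 r)"
  have "0 < a" unfolding a_def using content_ball_pos[OF \<open>0 < r\<close>, of x0] by simp
  \<comment> \<open>Chosen so that a K tau^2 pays both quadratic costs and leaves one extra
    tau^2.\<close>
  define K where "K = (G / 2 + c * m + 1) / a"
  \<comment> \<open>With tau > 1 and tau > c' m - B one gets tau^2 > tau > c' m - B, so the final
    bound c' m - tau^2 is below B.\<close>
  have "\<forall>\<^sub>F t in at_top. max 1 (c' * m - B) < (t :: real)" by (rule eventually_gt_at_top)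
  then have "\<exists>\<^sub>F t in at_top. K * t\<^sup>2 < F t \<and> max 1 (c' * m - B) < t"
    by (rule frequently_eventually_frequently[OF freq])
  then obtain \<tau> where \<tau>: "K * \<tau>\<^sup>2 < F \<tau>" "1 < \<tau>" "c' * m - B < \<tau>"
    using frequently_ex by force
  define w where "w x = \<tau> * \<psi> x" for x
  have w0: "0 \<le> w x" "w x \<le> \<tau>" for x
    using \<psi>(2,3)[of x] \<tau>(2) by (auto simp: w_def mult_left_le)
  have w: "w \<in> X0 s \<Omega>" using X0_add_scale[OF zero_in_X0 \<psi>(1), of \<tau>] by (simp add: w_def[abs_def])
  have gw: "gagliardo_form s w w = \<tau>\<^sup>2 * G"
    using gagliardo_form_add_scale[OF zero_in_X0 \<psi>(1), of \<tau>]
    by (simp add: w_def[abs_def] G_def gagliardo_form_def[of s "\<lambda>x. 0"])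
  have [measurable]: "w \<in> borel_measurable borel" "\<Omega> \<in> sets borel" using w \<Omega> by (auto simp: X0_iff)
  have [measurable]: "F \<in> borel_measurable borel" by (intro borel_measurable_continuous_onI F)
  obtain M where M: "\<And>t. t \<in> {0..\<tau>} \<Longrightarrow> \<bar>F t\<bar> \<le> M"
    using continuous_bounded_interval[OF F] by blast
  have iw: "integrable lborel (\<lambda>x. indicator \<Omega> x * F (w x))"
    by (rule integrable_indicator_bounded[OF \<Omega>(1,2), where M=M]) (use M w0 in auto)
  have ib: "integrable lborel (indicat_real (ball x0 r))"
    by (intro integrable_real_indicator emeasure_bounded_finite bounded_ball) auto
  have i\<Omega>: "integrable lborel (indicat_real \<Omega>)"
    by (intro integrable_real_indicator emeasure_bounded_finite \<Omega>) auto
  have "a * F \<tau> - m * (c * \<tau>\<^sup>2 + c') = (\<integral>x. indicator (ball x0 r) x * F \<tau> - indicator \<Omega> x * (c * \<tau>\<^sup>2 + c') \<partial>lborel)"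
    using ib i\<Omega> by (simp add: a_def m_def)
  also have "\<dots> \<le> (\<integral>x. indicator \<Omega> x * F (w x) \<partial>lborel)"
  proof (rule integral_mono[OF _ iw])
    show "integrable lborel (\<lambda>x. indicator (ball x0 r) x * F \<tau> - indicator \<Omega> x * (c * \<tau>\<^sup>2 + c'))"
      by (intro Bochner_Integration.integrable_diff integrable_mult_left ib i\<Omega>)
    fix x
    consider "x \<in> ball x0 r" | "x \<in> \<Omega>" "x \<notin> ball x0 r" | "x \<notin> \<Omega>" by blast
    then show "indicator (ball x0 r) x * F \<tau> - indicator \<Omega> x * (c * \<tau>\<^sup>2 + c') \<le> indicator \<Omega> x * F (w x)"
    proof cases
      case 1
      then have "w x = \<tau>" "x \<in> \<Omega>" using r(2,3) by (auto simp: w_def)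
      moreover have "0 \<le> c * \<tau>\<^sup>2 + c'" using \<open>0 \<le> c\<close> \<open>0 \<le> c'\<close> by simp
      ultimately show ?thesis using 1 by simp
    next
      case 2
      have "c * (w x)\<^sup>2 \<le> c * \<tau>\<^sup>2" by (intro mult_left_mono power_mono w0 \<open>0 \<le> c\<close>)
      with low[OF w0(1)[of x]] 2 show ?thesis by simp
    next
      case 3
      then show ?thesis using r(2) by (auto simp: indicator_def)
    qed
  qed
  finally have I: "a * F \<tau> - m * (c * \<tau>\<^sup>2 + c') \<le> (\<integral>x. indicator \<Omega> x * F (w x) \<partial>lborel)" .
  have "(G / 2 + c * m + 1) * \<tau>\<^sup>2 \<le> a * F \<tau>"
    using mult_left_mono[OF less_imp_le[OF \<tau>(1)], of a] \<open>0 < a\<close> by (simp add: K_def)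
  then have "energy s \<Omega> F w \<le> c' * m - \<tau>\<^sup>2"
    using I unfolding energy_def gw by (simp add: algebra_simps)
  also have "\<tau> < \<tau>\<^sup>2" using \<tau>(2) by (simp add: power2_eq_square)
  then have "c' * m - \<tau>\<^sup>2 < B" using \<tau>(3) by linarith
  finally show thesis using that[OF w w0] by blast
qed

text \<open>The quantifier order is the point: T and l depend on R but not on lam, so the levels can
  be stacked before lam is fixed. Exceeding R follows by energy comparison with a competitor that no
  function with values in [0,R] can match.\<close>

lemma bounded_solution_above_level:
  fixes \<Omega> :: "(real^'n) set" and f :: "real \<Rightarrow> real"
  assumes s: "0 < s" "s < 1" and \<Omega>: "open \<Omega>" "bounded \<Omega>" "\<Omega> \<noteq> {}"
    and fcont: "continuous_on {0..} f" and f0: "f 0 = 0"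
    and finf1: "Liminf at_top (\<lambda>t. ereal (integral {0..t} f / t\<^sup>2)) > -\<infinity>"
    and finf2: "Limsup at_top (\<lambda>t. ereal (integral {0..t} f / t\<^sup>2)) = \<infinity>"
    and finf3: "Liminf at_top (\<lambda>t. ereal (f t / t)) < 0"
    and p: "p > 1" and R: "0 \<le> R"
  shows "\<exists>T>R. \<exists>l>0. \<forall>lam\<in>{-l..l}. \<exists>u. weak_solution s \<Omega> p lam f u \<and> (\<forall>x. 0 \<le> u x \<and> u x \<le> T) \<and>
     \<not> (AE x in lborel. u x \<le> R)"
proof -
  define m where "m = measure lborel \<Omega>"
  have "0 \<le> m" by (simp add: m_def)
  have fm: "continuous_on UNIV (\<lambda>t. f (max t 0))"
    by (rule continuous_on_compose2[OF fcont]) (auto intro!: continuous_intros)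
  have fmm [measurable]: "(\<lambda>t. f (max t 0)) \<in> borel_measurable borel"
    by (rule borel_measurable_continuous_onI[OF fm])
  obtain F where F0: "F 0 = 0" and F: "\<And>t. (F has_real_derivative f (max t 0)) (at t)"
    using antiderivative_exists[OF fm] by metis
  have Fc: "continuous_on UNIV F" by (rule DERIV_continuous_on) (auto intro: F)
  have [measurable]: "F \<in> borel_measurable borel" by (intro borel_measurable_continuous_onI Fc)
  have FI: "integral {0..t} f = F t" if "0 \<le> t" for t
  proof -
    have "((\<lambda>t. f (max t 0)) has_integral (F t - F 0)) {0..t}"
      by (rule fundamental_theorem_of_calculus[OF that])
         (rule has_vector_derivative_at_within, rule F[unfolded has_real_derivative_iff_has_vector_derivative])
    then have "(f has_integral F t) {0..t}"
      by (rule has_integral_eq_rhs[OF has_integral_eq[rotated]]) (auto simp: F0 max_def)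
    then show ?thesis by (rule integral_unique)
  qed
  have freq: "\<exists>\<^sub>F t in at_top. K * t\<^sup>2 < F t" for K
  proof (rule ccontr)
    assume "\<not> (\<exists>\<^sub>F t in at_top. K * t\<^sup>2 < F t)"
    then have "\<forall>\<^sub>F t in at_top. F t \<le> K * t\<^sup>2" by (simp add: not_frequently not_less)
    then have "\<forall>\<^sub>F t in at_top. ereal (integral {0..t} f / t\<^sup>2) \<le> ereal K"
      using eventually_gt_at_top[of 0]
      by eventually_elim (simp add: FI divide_le_eq)
    then have "Limsup at_top (\<lambda>t. ereal (integral {0..t} f / t\<^sup>2)) \<le> ereal K" by (rule Limsup_bounded)
    then show False using finf2 by simp
  qed
  obtain c0 where "ereal c0 < Liminf at_top (\<lambda>t. ereal (integral {0..t} f / t\<^sup>2))"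
    using ereal_dense2[OF finf1] by blast
  then have "\<forall>\<^sub>F t in at_top. ereal c0 < ereal (integral {0..t} f / t\<^sup>2)" by (rule less_LiminfD)
  then have "\<forall>\<^sub>F t in at_top. c0 * t\<^sup>2 \<le> F t"
    using eventually_gt_at_top[of 0] by eventually_elim (simp add: FI less_divide_eq)
  then obtain t0 where t0: "\<And>t. t \<ge> t0 \<Longrightarrow> c0 * t\<^sup>2 \<le> F t" by (auto simp: eventually_at_top_linorder)
  obtain M0 where M0: "\<And>t. t \<in> {0..t0} \<Longrightarrow> \<bar>F t\<bar> \<le> M0" using continuous_bounded_interval[OF Fc] by blast
  define c where "c = \<bar>c0\<bar>"
  have c_nonneg: "0 \<le> c" by (simp add: c_def)
  \<comment> \<open>Beyond t0 the quadratic bound applies, before it compactness. The absolute value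
    of M0 matters: for negative t0 the interval is empty and M0 has no known sign.\<close>
  have low: "- c * t\<^sup>2 - \<bar>M0\<bar> \<le> F t" if "0 \<le> t" for t
  proof (cases "t0 \<le> t")
    case True
    have "- c * t\<^sup>2 \<le> c0 * t\<^sup>2" unfolding c_def by (intro mult_right_mono) auto
    then show ?thesis using t0[OF True] by linarith
  next
    case False
    then have "\<bar>F t\<bar> \<le> M0" using that M0 by auto
    moreover have "- c * t\<^sup>2 \<le> 0" by (simp add: c_def)
    ultimately show ?thesis by linarith
  qed
  obtain MR where MR: "\<And>t. t \<in> {0..R} \<Longrightarrow> \<bar>F t\<bar> \<le> MR" using continuous_bounded_interval[OF Fc] by blast
  \<comment> \<open>Functions with values in [0,R] have energy at least -(MR m) with respect to F;
    the target lies 1 below this.\<close>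
  obtain w \<tau> where w: "w \<in> X0 s \<Omega>" "\<And>x. 0 \<le> w x" "\<And>x. w x \<le> \<tau>" and wE: "energy s \<Omega> F w < - (MR * m) - 1"
    using low_energy_function[where B="- (MR * m) - 1", OF s \<Omega> Fc low c_nonneg abs_ge_zero freq] by blast
  have "\<exists>\<^sub>F t in at_top. f t / t < 0"
  proof (rule ccontr)
    assume "\<not> (\<exists>\<^sub>F t in at_top. f t / t < 0)"
    then have "\<forall>\<^sub>F t in at_top. 0 \<le> ereal (f t / t)" by (simp add: not_frequently not_less)
    then have "0 \<le> Liminf at_top (\<lambda>t. ereal (f t / t))" by (rule Liminf_bounded)
    then show False using finf3 by simp
  qed
  \<comment> \<open>Taking T beyond tau keeps the values of w in [0,T], where G and F are
    comparable.\<close>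
  then have "\<exists>\<^sub>F t in at_top. f t / t < 0 \<and> max 0 (max R \<tau>) < t"
    by (rule frequently_eventually_frequently) (rule eventually_gt_at_top)
  then obtain T where "f T / T < 0" "0 < T" "R < T" "\<tau> < T"
    using frequently_ex by force
  then have "f T < 0" by (simp add: divide_less_0_iff)
  \<comment> \<open>The first entry keeps the nonlinearity nonpositive at T, the second limits the
    change of the potential to 1/4. The + 1 keeps the denominator positive.\<close>
  define l where "l = min (- f T / T powr p) (1 / (4 * (T powr p * T * m + 1)))"
  have pos: "0 < T powr p" "0 < T powr p * T * m + 1"
    using \<open>0 < T\<close> \<open>0 \<le> m\<close> by (auto intro: add_nonneg_pos)
  have "0 < l" using pos \<open>f T < 0\<close> by (simp add: l_def divide_neg_pos)
  have "\<exists>u. weak_solution s \<Omega> p lam f u \<and> (\<forall>x. 0 \<le> u x \<and> u x \<le> T) \<and> \<not> (AE x in lborel. u x \<le> R)"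
    if "lam \<in> {-l..l}" for lam
  proof -
    have lam: "\<bar>lam\<bar> \<le> l" using that by auto
    have "\<bar>lam\<bar> \<le> - f T / T powr p" using lam by (simp add: l_def)
    then have "\<bar>lam\<bar> * T powr p \<le> - f T" using pos by (simp add: field_simps)
    moreover have "lam * T powr p \<le> \<bar>lam\<bar> * T powr p" by (intro mult_right_mono) auto
    ultimately have gT: "lam * T powr p + f T \<le> 0" by linarith
    define e where "e = \<bar>lam\<bar> * T powr p * T"
    have "0 \<le> e" using \<open>0 < T\<close> by (simp add: e_def)
    have em: "e * m \<le> 1 / 4"
    proof -
      have "e * m = \<bar>lam\<bar> * (T powr p * T * m)" by (simp add: e_def mult_ac)
      also have "\<dots> \<le> \<bar>lam\<bar> * (T powr p * T * m + 1)" by (intro mult_left_mono) auto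
      also have "\<dots> \<le> 1 / (4 * (T powr p * T * m + 1)) * (T powr p * T * m + 1)"
        by (intro mult_right_mono) (use lam pos in \<open>auto simp: l_def\<close>)
      also have "\<dots> = 1 / 4" using pos by (simp add: field_simps)
      finally show ?thesis .
    qed
    define g where "g t = lam * clamp_to T t powr p + f (clamp_to T t)" for t
    have clamp0: "0 \<le> clamp_to T t" "clamp_to T t \<le> T" for t using \<open>0 < T\<close> by (auto simp: clamp_to_def)
    have gc: "continuous_on UNIV g"
      unfolding g_def
      by (intro continuous_intros continuous_on_powr' continuous_on_compose2[OF fcont])
         (use clamp0 p in auto)
    obtain G where G0: "G 0 = 0" and G: "\<And>t. (G has_real_derivative g t) (at t)"
      using antiderivative_exists[OF gc] by metis
    obtain C where C: "\<And>t. t \<in> {0..T} \<Longrightarrow> \<bar>g t\<bar> \<le> C"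
      using continuous_bounded_interval[OF gc] by blast
    interpret truncated_nonlinearity g G T C
    proof
      show "\<bar>g t\<bar> \<le> C" for t
      proof -
        have "g t = g (clamp_to T t)" using \<open>0 < T\<close> by (simp add: g_def clamp_to_def)
        then show ?thesis using C[of "clamp_to T t"] clamp0 by simp
      qed
      show "g t = 0" if "t \<le> 0" for t
        using that \<open>0 < T\<close> f0 p by (simp add: g_def clamp_to_def)
      show "g t \<le> 0" if "T \<le> t" for t
        using that \<open>0 < T\<close> gT by (simp add: g_def clamp_to_def)
    qed (use gc G G0 \<open>0 < T\<close> in auto)
    obtain u where u: "u \<in> X0 s \<Omega>" "\<And>x. 0 \<le> u x" "\<And>x. u x \<le> T"
      and min: "\<And>v. v \<in> X0 s \<Omega> \<Longrightarrow> energy s \<Omega> G u \<le> energy s \<Omega> G v"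
      using energy_minimizer_exists[OF \<Omega>(1,2) s(1)] by blast
    have um [measurable]: "u \<in> borel_measurable borel" and [measurable]: "\<Omega> \<in> sets borel" "w \<in> borel_measurable borel"
      using u w \<Omega> by (auto simp: X0_iff)
    have gu: "g (u x) = lam * max (u x) 0 powr p + f (max (u x) 0)" for x
      using u(2,3)[of x] \<open>0 < T\<close> by (simp add: g_def clamp_to_def max_def)
    \<comment> \<open>On [0,T] the derivatives of G and F differ by lam z^p, at most |lam| T^p in
      modulus; integrating over a length of at most T gives e.\<close>
    have GF: "\<bar>G t - F t\<bar> \<le> e" if t: "t \<in> {0..T}" for t
    proof -
      have "norm ((G t - F t) - (G 0 - F 0)) \<le> \<bar>lam\<bar> * T powr p * norm (t - 0)"
      proof (rule field_differentiable_bound[of "{0..T}"])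
        fix z assume z: "z \<in> {0..T}"
        show "((\<lambda>t. G t - F t) has_field_derivative g z - f (max z 0)) (at z within {0..T})"
          by (intro derivative_intros DERIV_subset[OF G] DERIV_subset[OF F]) auto
        have "clamp_to T z = z" "max z 0 = z" using z by (auto simp: clamp_to_def)
        then have "g z - f (max z 0) = lam * z powr p" by (simp add: g_def)
        moreover have "z powr p \<le> T powr p" using z p by (intro powr_mono2) auto
        ultimately show "norm (g z - f (max z 0)) \<le> \<bar>lam\<bar> * T powr p"
          by (simp add: abs_mult mult_left_mono)
      qed (use t in auto)
      also have "\<dots> \<le> e" unfolding e_def by (intro mult_left_mono) (use t in auto)
      finally show ?thesis by (simp add: F0 G0)
    qed
    have sol: "weak_solution s \<Omega> p lam f u"
      unfolding weak_solution_def
    proof (intro conjI ballI u(1))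
      fix \<phi> assume \<phi>: "\<phi> \<in> X0 s \<Omega>"
      have i1: "integrable lborel (\<lambda>x. indicator \<Omega> x * (max (u x) 0 powr p * \<phi> x))"
      proof (rule X0_bounded_mult_integrable[OF _ _ \<phi> \<Omega>(1,2)])
        show "\<bar>max (u x) 0 powr p\<bar> \<le> T powr p" for x
          using u(2,3)[of x] p by (auto intro!: powr_mono2)
      qed measurable
      obtain D where D: "\<And>t. t \<in> {0..T} \<Longrightarrow> \<bar>f (max t 0)\<bar> \<le> D"
        using continuous_bounded_interval[OF fm] by blast
      have i2: "integrable lborel (\<lambda>x. indicator \<Omega> x * (f (max (u x) 0) * \<phi> x))"
      proof (rule X0_bounded_mult_integrable[OF _ _ \<phi> \<Omega>(1,2)])
        show "\<bar>f (max (u x) 0)\<bar> \<le> D" for x using D[of "u x"] u(2,3)[of x] by simp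
        show "(\<lambda>x. f (max (u x) 0)) \<in> borel_measurable borel"
          using measurable_compose[OF um fmm] .
      qed
      show "set_integrable lborel \<Omega> (\<lambda>x. max (u x) 0 powr p * \<phi> x)"
        "set_integrable lborel \<Omega> (\<lambda>x. f (max (u x) 0) * \<phi> x)"
        using i1 i2 by (simp_all add: set_integrable_def)
      have "gagliardo_form s u \<phi> = (\<integral>x. indicator \<Omega> x * (g (u x) * \<phi> x) \<partial>lborel)"
        by (rule euler_lagrange[OF \<Omega>(1,2) s(1) u(1) min \<phi>])
      also have "\<dots> = (\<integral>x. lam * (indicator \<Omega> x * (max (u x) 0 powr p * \<phi> x)) + indicator \<Omega> x * (f (max (u x) 0) * \<phi> x) \<partial>lborel)"
        unfolding gu by (simp add: algebra_simps)
      also have "\<dots> = lam * (LINT x:\<Omega>|lborel. max (u x) 0 powr p * \<phi> x) + (LINT x:\<Omega>|lborel. f (max (u x) 0) * \<phi> x)"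
        using i1 i2 by (simp add: set_lebesgue_integral_def)
      finally show "gagliardo_form s u \<phi> = lam * (LINT x:\<Omega>|lborel. max (u x) 0 powr p * \<phi> x) + (LINT x:\<Omega>|lborel. f (max (u x) 0) * \<phi> x)" .
    qed
    \<comment> \<open>If u stayed below R, its frozen energy would be at least -(MR m) - 1/4, while
      that of w is below -(MR m) - 3/4: each exchange of F for G costs at most e m.\<close>
    have "\<not> (AE x in lborel. u x \<le> R)"
    proof
      assume ae: "AE x in lborel. u x \<le> R"
      have w0: "w x \<in> {0..T}" for x using w(2,3)[of x] \<open>\<tau> < T\<close> by auto
      have iG: "integrable lborel (\<lambda>x. indicator \<Omega> x * G (v x))" if "v \<in> X0 s \<Omega>" for v
        using integrable_H[OF \<Omega>(1,2) s(1) that] .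
      have const: "integrable lborel (\<lambda>x. indicator \<Omega> x * a)" "(\<integral>x. indicator \<Omega> x * a \<partial>lborel) = a * m" for a :: real
        using integrable_indicator_bounded[OF \<Omega>(1,2), of "\<lambda>_. a" "\<bar>a\<bar>"] by (auto simp: m_def)
      obtain D where D: "\<And>t. t \<in> {0..T} \<Longrightarrow> \<bar>F t\<bar> \<le> D" using continuous_bounded_interval[OF Fc] by blast
      have iF: "integrable lborel (\<lambda>x. indicator \<Omega> x * F (w x))"
        by (rule integrable_indicator_bounded[OF \<Omega>(1,2), where M=D]) (use D w0 in auto)
      have "(\<integral>x. indicator \<Omega> x * F (w x) \<partial>lborel) \<le> (\<integral>x. indicator \<Omega> x * G (w x) + indicator \<Omega> x * e \<partial>lborel)"
      proof (rule integral_mono[OF iF])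
        show "integrable lborel (\<lambda>x. indicator \<Omega> x * G (w x) + indicator \<Omega> x * e)"
          by (intro Bochner_Integration.integrable_add iG w(1) const)
        show "indicator \<Omega> x * F (w x) \<le> indicator \<Omega> x * G (w x) + indicator \<Omega> x * e" for x
          using abs_le_D2[OF GF[OF w0[of x]]] by (cases "x \<in> \<Omega>") auto
      qed
      also have "\<dots> = (\<integral>x. indicator \<Omega> x * G (w x) \<partial>lborel) + e * m"
        by (subst Bochner_Integration.integral_add) (simp_all only: iG w(1) const)
      finally have 1: "energy s \<Omega> G w \<le> energy s \<Omega> F w + e * m" unfolding energy_def by linarith
      have "(\<integral>x. indicator \<Omega> x * G (u x) \<partial>lborel) \<le> (\<integral>x. indicator \<Omega> x * (MR + e) \<partial>lborel)"
      proof (rule integral_mono_AE[OF iG[OF u(1)] const(1)])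
        show "AE x in lborel. indicator \<Omega> x * G (u x) \<le> indicator \<Omega> x * (MR + e)"
          using ae
        proof eventually_elim
          case (elim x)
          have "G (u x) \<le> F (u x) + e" using abs_le_D1[OF GF[of "u x"]] u(2,3)[of x] by simp
          also have "F (u x) \<le> MR" using abs_le_D1[OF MR[of "u x"]] u(2)[of x] elim by simp
          finally show ?case by (simp add: indicator_def)
        qed
      qed
      then have "- ((MR + e) * m) \<le> energy s \<Omega> G u"
        using gagliardo_form_self_nonneg[of s u] unfolding energy_def const by linarith
      then have "- (MR * m) - e * m \<le> energy s \<Omega> G u" by (simp add: algebra_simps)
      with min[OF w(1)] 1 wE em show False by linarith
    qed
    with sol u(2,3) show ?thesis by blast
  qed
  with \<open>R < T\<close> \<open>0 < l\<close> show ?thesis by blast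
qed

text \<open>An essential bound by c on the domain, together with vanishing outside and 0 <= r, would
  give u <= r a.e. on the whole space.\<close>

lemma esssup_gt:
  assumes um [measurable]: "u \<in> borel_measurable borel" and [measurable]: "\<Omega> \<in> sets borel"
    and out: "AE x in lborel. x \<notin> \<Omega> \<longrightarrow> u x = 0"
    and n: "\<not> (AE x in lborel. u x \<le> r)" and "0 \<le> r" "c \<le> r"
  shows "ereal c < esssup (restrict_space lborel \<Omega>) (\<lambda>x. ereal \<bar>u x\<bar>)"
proof (rule ccontr)
  assume "\<not> ?thesis"
  then have le: "esssup (restrict_space lborel \<Omega>) (\<lambda>x. ereal \<bar>u x\<bar>) \<le> ereal c" by simp
  have "AE x in restrict_space lborel \<Omega>. ereal \<bar>u x\<bar> \<le> esssup (restrict_space lborel \<Omega>) (\<lambda>x. ereal \<bar>u x\<bar>)"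
    by (rule esssup_AE)
  then have "AE x in restrict_space lborel \<Omega>. u x \<le> r"
  proof eventually_elim
    case (elim x)
    then have "ereal \<bar>u x\<bar> \<le> ereal c" using le by (rule order_trans)
    then show ?case using \<open>c \<le> r\<close> by simp
  qed
  then have "AE x in lborel. x \<in> \<Omega> \<longrightarrow> u x \<le> r" by (subst (asm) AE_restrict_space_iff) auto
  with out have "AE x in lborel. u x \<le> r" by eventually_elim (use \<open>0 \<le> r\<close> in auto)
  with n show False ..
qed

theorem theorem1p4:
  fixes \<Omega> :: "(real^'n) set" and s p :: real and f :: "real \<Rightarrow> real"
  assumes N2: "CARD('n) \<ge> 2"
    and s: "0 < s" "s < 1"
    and N2s: "real CARD('n) > 2 * s"
    and dom: "bounded_smooth_domain \<Omega>"
    and fcont: "continuous_on {0..} f"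
    and f0: "f 0 = 0"
    and finf1: "Liminf at_top (\<lambda>t. ereal (integral {0..t} f / t\<^sup>2)) > -\<infinity>"
    and finf2: "Limsup at_top (\<lambda>t. ereal (integral {0..t} f / t\<^sup>2)) = \<infinity>"
    and finf3: "Liminf at_top (\<lambda>t. ereal (f t / t)) < 0"
    and p: "p > 1"
  shows "\<forall>k::nat. \<exists>lk>0. \<forall>lam\<in>{-lk..lk}. \<exists>u :: nat \<Rightarrow> (real^'n \<Rightarrow> real).
           (\<forall>i\<in>{1..k}. weak_solution s \<Omega> p lam f (u i)
              \<and> (AE x in lborel. u i x \<ge> 0)
              \<and> \<not> (AE x in lborel. u i x = 0)
              \<and> esssup (restrict_space lborel \<Omega>) (\<lambda>x. ereal \<bar>u i x\<bar>) > ereal (real i - 1))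
         \<and> (\<forall>i\<in>{1..k}. \<forall>j\<in>{1..k}. i \<noteq> j \<longrightarrow> \<not> (AE x in lborel. u i x = u j x))"
proof
  fix k :: nat
  have \<Omega>: "open \<Omega>" "bounded \<Omega>" "\<Omega> \<noteq> {}" using dom by (auto simp: bounded_smooth_domain_def)
  have [measurable]: "\<Omega> \<in> sets borel" using \<Omega> by auto
  have "\<forall>R. \<exists>T l. 0 \<le> R \<longrightarrow> R < T \<and> 0 < l \<and> (\<forall>lam\<in>{-l..l}. \<exists>u. weak_solution s \<Omega> p lam f u \<and>
       (\<forall>x. 0 \<le> u x \<and> u x \<le> T) \<and> \<not> (AE x in lborel. u x \<le> R))"
    using bounded_solution_above_level[OF s \<Omega> fcont f0 finf1 finf2 finf3 p] by blast
  then obtain T l where "\<forall>R. 0 \<le> R \<longrightarrow> R < T R \<and> 0 < l R \<and> (\<forall>lam\<in>{- l R..l R}. \<exists>u. weak_solution s \<Omega> p lam f u \<and>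
       (\<forall>x. 0 \<le> u x \<and> u x \<le> T R) \<and> \<not> (AE x in lborel. u x \<le> R))"
    unfolding choice_iff by blast
  then have Tl: "\<And>R. 0 \<le> R \<Longrightarrow> R < T R" "\<And>R. 0 \<le> R \<Longrightarrow> 0 < l R"
    "\<And>R lam. 0 \<le> R \<Longrightarrow> lam \<in> {- l R..l R} \<Longrightarrow> \<exists>u. weak_solution s \<Omega> p lam f u \<and>
       (\<forall>x. 0 \<le> u x \<and> u x \<le> T R) \<and> \<not> (AE x in lborel. u x \<le> R)"
    by blast+
  \<comment> \<open>The first entry of the maximum separates consecutive solutions, the second
    forces R i >= i and hence the norm bound.\<close>
  define R where "R = rec_nat 0 (\<lambda>i r. max (T r) (real (Suc i)))"
  have R_Suc: "R (Suc i) = max (T (R i)) (real (Suc i))" for i by (simp add: R_def)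
  have R_ge: "real i \<le> R i" for i by (cases i) (auto simp: R_Suc, simp add: R_def)
  have R0: "0 \<le> R i" for i using R_ge[of i] by linarith
  have "R i \<le> R (Suc i)" for i using Tl(1)[OF R0[of i]] by (simp add: R_Suc)
  then have R_mono: "i \<le> j \<Longrightarrow> R i \<le> R j" for i j by (rule lift_Suc_mono_le)
  have T_le: "T (R i) \<le> R j" if "i < j" for i j
    using R_mono[of "Suc i" j] that by (simp add: R_Suc)
  \<comment> \<open>The inserted 1 keeps the set nonempty when k = 0.\<close>
  define lk where "lk = Min (insert 1 ((\<lambda>i. l (R i)) ` {1..k}))"
  have "0 < lk" unfolding lk_def by (subst Min_gr_iff) (use Tl(2) R0 in auto)
  moreover have lk: "lk \<le> l (R i)" if "i \<in> {1..k}" for i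
    unfolding lk_def using that by (intro Min_le) auto
  have "\<exists>u. (\<forall>i\<in>{1..k}. weak_solution s \<Omega> p lam f (u i)
              \<and> (AE x in lborel. u i x \<ge> 0)
              \<and> \<not> (AE x in lborel. u i x = 0)
              \<and> esssup (restrict_space lborel \<Omega>) (\<lambda>x. ereal \<bar>u i x\<bar>) > ereal (real i - 1))
         \<and> (\<forall>i\<in>{1..k}. \<forall>j\<in>{1..k}. i \<noteq> j \<longrightarrow> \<not> (AE x in lborel. u i x = u j x))"
    if lam: "lam \<in> {-lk..lk}" for lam
  proof -
    have "\<forall>i\<in>{1..k}. \<exists>u. weak_solution s \<Omega> p lam f u \<and> (\<forall>x. 0 \<le> u x \<and> u x \<le> T (R i)) \<and> \<not> (AE x in lborel. u x \<le> R i)"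
    proof
      fix i assume "i \<in> {1..k}"
      then have "lam \<in> {- l (R i)..l (R i)}" using lk[of i] lam by auto
      then show "\<exists>u. weak_solution s \<Omega> p lam f u \<and> (\<forall>x. 0 \<le> u x \<and> u x \<le> T (R i)) \<and> \<not> (AE x in lborel. u x \<le> R i)"
        by (rule Tl(3)[OF R0])
    qed
    from bchoice[OF this] obtain u where "\<forall>i\<in>{1..k}. weak_solution s \<Omega> p lam f (u i) \<and> (\<forall>x. 0 \<le> u i x \<and> u i x \<le> T (R i)) \<and> \<not> (AE x in lborel. u i x \<le> R i)"
      by blast
    then have u: "\<And>i. i \<in> {1..k} \<Longrightarrow> weak_solution s \<Omega> p lam f (u i)"
      "\<And>i x. i \<in> {1..k} \<Longrightarrow> 0 \<le> u i x" "\<And>i x. i \<in> {1..k} \<Longrightarrow> u i x \<le> T (R i)"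
      "\<And>i. i \<in> {1..k} \<Longrightarrow> \<not> (AE x in lborel. u i x \<le> R i)"
      by blast+
    \<comment> \<open>The earlier solution lies below \<open>T (R i)\<close>, hence below
      \<open>R j\<close>, a level that the later one exceeds on a set of positive measure.\<close>
    have distinct: "\<not> (AE x in lborel. u i x = u j x)" if ij: "i \<in> {1..k}" "j \<in> {1..k}" "i < j" for i j
    proof
      assume "AE x in lborel. u i x = u j x"
      then have "AE x in lborel. u j x \<le> R j"
      proof eventually_elim
        case (elim x)
        show ?case using u(3)[OF ij(1), of x] T_le[OF ij(3)] unfolding elim by (rule order_trans)
      qed
      with u(4)[OF ij(2)] show False ..
    qed
    show ?thesis
    proof (intro exI[of _ u] conjI ballI impI)
      fix i assume i: "i \<in> {1..k}"
      show "weak_solution s \<Omega> p lam f (u i)" using u(1)[OF i] .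
      show "AE x in lborel. u i x \<ge> 0" using u(2)[OF i] by simp
      show "\<not> (AE x in lborel. u i x = 0)"
      proof
        assume "AE x in lborel. u i x = 0"
        then have "AE x in lborel. u i x \<le> R i" by eventually_elim (simp add: R0)
        with u(4)[OF i] show False ..
      qed
      have X: "u i \<in> X0 s \<Omega>" using u(1)[OF i] by (simp add: weak_solution_def)
      show "ereal (real i - 1) < esssup (restrict_space lborel \<Omega>) (\<lambda>x. ereal \<bar>u i x\<bar>)"
        by (rule esssup_gt[OF _ _ _ u(4)[OF i] R0]) (use X R_ge[of i] in \<open>auto simp: X0_iff\<close>)
    next
      fix i j assume ij: "i \<in> {1..k}" "j \<in> {1..k}" "i \<noteq> j"
      show "\<not> (AE x in lborel. u i x = u j x)"
      proof (cases "i < j")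
        case True
        then show ?thesis by (rule distinct[OF ij(1,2)])
      next
        case False
        then have "j < i" using ij(3) by simp
        from distinct[OF ij(2,1) this] show ?thesis by (simp add: eq_commute)
      qed
    qed
  qed
  ultimately show "\<exists>lk>0. \<forall>lam\<in>{-lk..lk}. \<exists>u :: nat \<Rightarrow> (real^'n \<Rightarrow> real).
           (\<forall>i\<in>{1..k}. weak_solution s \<Omega> p lam f (u i)
              \<and> (AE x in lborel. u i x \<ge> 0)
              \<and> \<not> (AE x in lborel. u i x = 0)
              \<and> esssup (restrict_space lborel \<Omega>) (\<lambda>x. ereal \<bar>u i x\<bar>) > ereal (real i - 1))
         \<and> (\<forall>i\<in>{1..k}. \<forall>j\<in>{1..k}. i \<noteq> j \<longrightarrow> \<not> (AE x in lborel. u i x = u j x))"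
    by blast
qed

end
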